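(* Let $(A,B,P)$ be a c.n.u. $\mathbb E$-contraction on a Hilbert space $\mathcal H$ such that $A^*P=PA^*$ and $B^*P=PB^*$. Let $\mathcal H=\mathcal H_1^\circ\oplus\mathcal H_2^\circ\oplus\mathcal H_3^\circ$ be the unique orthogonal decomposition of $\mathcal H$ determined by the c.n.u. contraction $P$ in which $\mathcal H_1^\circ=\{x:\lim_k\|P^kx\|=0\}$, $\mathcal H_3^\circ=\{x:\lim_k\|P^kx\|=\|x\|\}$ and $\mathcal H_2^\circ$ is the orthogonal complement of $\mathcal H_1^\circ\oplus\mathcal H_3^\circ$. Then: (1) $\mathcal H_1^\circ$ and $\mathcal H_3^\circ$ are joint invariant subspaces for $A$, $B$ and $P$; (2) $\mathcal H_2^\circ$ is a joint invariant subspace for $A^*$, $B^*$ and $P^*$; (3) $((A|_{\mathcal H_1^\circ})^*,(B|_{\mathcal H_1^\circ})^*,(P|_{\mathcal H_1^\circ})^* )$ is a pure $\mathbb E$-contraction; (4) $(A^*|_{\mathcal H_2^\circ},B^*|_{\mathcal H_2^\circ},P^*|_{\mathcal H_2^\circ})$ is a c.n.u. $\mathbb E$-contraction; (5) $(A|_{\mathcal H_3^\circ},B|_{\mathcal H_3^\circ},P|_{\mathcal H_3^\circ})$ is a c.n.u. $\mathbb E$-isometry.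
   Context: All operators are bounded linear operators on complex Hilbert spaces; subspaces are closed. The tetrablock is $\mathbb E=\{(x_1,x_2,x_3)\in\mathbb C^3:1-zx_1-wx_2+zwx_3\ne0\ \ \forall z,w\in\overline{\mathbb D}\}$, and $b\mathbb E=\{(a,b,p)\in\overline{\mathbb E}:|p|=1\}$. A compact set $K\subset\mathbb C^3$ is a spectral set for a commuting triple $\underline T$ if the Taylor joint spectrum of $\underline T$ lies in $K$ and $\|f(\underline T)\|\le\sup_K|f|$ for every rational function $f$ with poles off $K$. An $\mathbb E$-contraction is a commuting triple $(A,B,P)$ having $\overline{\mathbb E}$ as a spectral set (then $P$ is a contraction). An $\mathbb E$-unitary is a commuting triple of normal operators with Taylor joint spectrum contained in $b\mathbb E$. An $\mathbb E$-isometry is the restriction of an $\mathbb E$-unitary to a joint invariant subspace. A contraction is c.n.u. (completely non-unitary) if no nonzero reducing subspace exists on which it is unitary. An $\mathbb E$-contraction $(A,B,P)$ is c.n.u. if $P$ is c.n.u., and pure if $\|P^{*k}x\|\to0$ for all $x$. Known one-variable fact: for a c.n.u. contraction $P$ on $\mathcal H$, $\mathcal H$ admits a unique orthogonal decomposition $\mathcal H_1^\circ\oplus\mathcal H_2^\circ\oplus\mathcal H_3^\circ$, with $\mathcal H_1^\circ,\mathcal H_3^\circ$ invariant for $P$ and $\mathcal H_2^\circ$ invariant for $P^*$, such that $\lim_k\|P^kx\|$ equals $0$ for $x\in\mathcal H_1^\circ$, is $<\|x\|$ for nonzero $x\in\mathcal H_2^\circ$, and equals $\|x\|$ for $x\in\mathcal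 H_3^\circ$; these are the subspaces described in the statement. *)

theory Defs
  imports "HOL-Analysis.Analysis" "HOL-Library.Poly_Mapping"
begin

section \<open>Complex Hilbert spaces\<close>

text \<open>The complex inner product is linear in the first argument; its real part is the inner
  product of the underlying real Hilbert space, so norm and topology are the library's.\<close>

class complex_hilbert = real_inner + banach +
  fixes scaleC :: "complex \<Rightarrow> 'a \<Rightarrow> 'a" (infixr "*\<^sub>C" 75)
    and cinner :: "'a \<Rightarrow> 'a \<Rightarrow> complex"
  assumes scaleC_add_right: "c *\<^sub>C (x + y) = c *\<^sub>C x + c *\<^sub>C y"
    and scaleC_add_left: "(c + d) *\<^sub>C x = c *\<^sub>C x + d *\<^sub>C x"
    and scaleC_scaleC: "c *\<^sub>C d *\<^sub>C x = (c * d) *\<^sub>C x"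
    and scaleC_of_real: "of_real r *\<^sub>C x = r *\<^sub>R x"
    and cinner_commute: "cinner x y = cnj (cinner y x)"
    and cinner_add_left: "cinner (x + y) z = cinner x z + cinner y z"
    and cinner_scaleC_left: "cinner (c *\<^sub>C x) y = c * cinner x y"
    and Re_cinner: "Re (cinner x y) = inner x y"

definition closed_csubspace :: "'a::complex_hilbert set \<Rightarrow> bool" where
  "closed_csubspace M \<longleftrightarrow> closed M \<and> 0 \<in> M \<and> (\<forall>x\<in>M. \<forall>y\<in>M. x + y \<in> M) \<and>
     (\<forall>c. \<forall>x\<in>M. c *\<^sub>C x \<in> M)"

definition invariant_subspace :: "('a::complex_hilbert \<Rightarrow> 'a) \<Rightarrow> 'a set \<Rightarrow> bool" where
  "invariant_subspace T M \<longleftrightarrow> closed_csubspace M \<and> T ` M \<subseteq> M"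

definition joint_invariant_subspace ::
  "('a::complex_hilbert \<Rightarrow> 'a) \<Rightarrow> ('a \<Rightarrow> 'a) \<Rightarrow> ('a \<Rightarrow> 'a) \<Rightarrow> 'a set \<Rightarrow> bool" where
  "joint_invariant_subspace A B P M \<longleftrightarrow>
     invariant_subspace A M \<and> invariant_subspace B M \<and> invariant_subspace P M"

definition orth_compl :: "'a::complex_hilbert set \<Rightarrow> 'a set" where
  "orth_compl S = {x. \<forall>y\<in>S. cinner x y = 0}"


section \<open>Operators on a closed subspace\<close>

text \<open>A Hilbert space is represented by a closed subspace \<open>M\<close> of a type of class
  \<open>complex_hilbert\<close> (\<open>UNIV\<close> for the whole type), and an operator on it by a total function of
  which only the values on \<open>M\<close> matter. In particular the restriction of \<open>T\<close> to an
  invariant subspace \<open>N\<close> is represented by \<open>T\<close> itself, regarded as an operator on \<open>N\<close>.\<close>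

definition bounded_op_on :: "'a::complex_hilbert set \<Rightarrow> ('a \<Rightarrow> 'a) \<Rightarrow> bool" where
  "bounded_op_on M T \<longleftrightarrow> closed_csubspace M \<and> T ` M \<subseteq> M \<and>
     (\<forall>x\<in>M. \<forall>y\<in>M. T (x + y) = T x + T y) \<and>
     (\<forall>c. \<forall>x\<in>M. T (c *\<^sub>C x) = c *\<^sub>C T x) \<and>
     (\<exists>K. \<forall>x\<in>M. norm (T x) \<le> K * norm x)"

definition op_norm_le_on :: "'a::complex_hilbert set \<Rightarrow> ('a \<Rightarrow> 'a) \<Rightarrow> real \<Rightarrow> bool" where
  "op_norm_le_on M T c \<longleftrightarrow> (\<forall>x\<in>M. norm (T x) \<le> c * norm x)"

text \<open>The adjoint of \<open>T\<close> as an operator on \<open>M\<close>, so \<open>adj_on N T\<close> is \<open>(T|N)*\<close>, not \<open>T*|N\<close>.\<close>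

definition adj_on :: "'a::complex_hilbert set \<Rightarrow> ('a \<Rightarrow> 'a) \<Rightarrow> 'a \<Rightarrow> 'a" where
  "adj_on M T y = (THE z. z \<in> M \<and> (\<forall>x\<in>M. cinner (T x) y = cinner x z))"

abbreviation adj :: "('a::complex_hilbert \<Rightarrow> 'a) \<Rightarrow> 'a \<Rightarrow> 'a" where
  "adj \<equiv> adj_on UNIV"

definition normal_on :: "'a::complex_hilbert set \<Rightarrow> ('a \<Rightarrow> 'a) \<Rightarrow> bool" where
  "normal_on M T \<longleftrightarrow> bounded_op_on M T \<and> (\<forall>x\<in>M. adj_on M T (T x) = T (adj_on M T x))"

definition unitary_on :: "'a::complex_hilbert set \<Rightarrow> ('a \<Rightarrow> 'a) \<Rightarrow> bool" where
  "unitary_on M T \<longleftrightarrow> bounded_op_on M T \<and>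
     (\<forall>x\<in>M. adj_on M T (T x) = x \<and> T (adj_on M T x) = x)"

definition contraction_on :: "'a::complex_hilbert set \<Rightarrow> ('a \<Rightarrow> 'a) \<Rightarrow> bool" where
  "contraction_on M T \<longleftrightarrow> bounded_op_on M T \<and> op_norm_le_on M T 1"

definition reducing_on :: "'a::complex_hilbert set \<Rightarrow> ('a \<Rightarrow> 'a) \<Rightarrow> 'a set \<Rightarrow> bool" where
  "reducing_on M T N \<longleftrightarrow> N \<subseteq> M \<and> invariant_subspace T N \<and> invariant_subspace (adj_on M T) N"

definition cnu_on :: "'a::complex_hilbert set \<Rightarrow> ('a \<Rightarrow> 'a) \<Rightarrow> bool" where
  "cnu_on M T \<longleftrightarrow> contraction_on M T \<and>
     \<not> (\<exists>N. N \<noteq> {0} \<and> reducing_on M T N \<and> unitary_on N T)"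

definition pure_on :: "'a::complex_hilbert set \<Rightarrow> ('a \<Rightarrow> 'a) \<Rightarrow> bool" where
  "pure_on M T \<longleftrightarrow> (\<forall>x\<in>M. (\<lambda>k. norm ((adj_on M T ^^ k) x)) \<longlonglongrightarrow> 0)"

definition commuting_triple_on ::
  "'a::complex_hilbert set \<Rightarrow> ('a \<Rightarrow> 'a) \<Rightarrow> ('a \<Rightarrow> 'a) \<Rightarrow> ('a \<Rightarrow> 'a) \<Rightarrow> bool" where
  "commuting_triple_on M A B P \<longleftrightarrow> bounded_op_on M A \<and> bounded_op_on M B \<and> bounded_op_on M P \<and>
     (\<forall>x\<in>M. A (B x) = B (A x) \<and> A (P x) = P (A x) \<and> B (P x) = P (B x))"


section \<open>Taylor joint spectrum of a triple\<close>

text \<open>The Koszul complex \<open>0 \<rightarrow> M \<rightarrow> M^3 \<rightarrow> M^3 \<rightarrow> M \<rightarrow> 0\<close>, with the bases \<open>e1, e2, e3\<close> in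
  degree 1 and \<open>e1 \<and> e2, e1 \<and> e3, e2 \<and> e3\<close> in degree 2.\<close>

definition koszul0 :: "('a \<Rightarrow> 'a) \<Rightarrow> ('a \<Rightarrow> 'a) \<Rightarrow> ('a \<Rightarrow> 'a) \<Rightarrow> 'a \<Rightarrow> 'a \<times> 'a \<times> 'a" where
  "koszul0 A B C x = (A x, B x, C x)"

definition koszul1 :: "('a::complex_hilbert \<Rightarrow> 'a) \<Rightarrow> ('a \<Rightarrow> 'a) \<Rightarrow> ('a \<Rightarrow> 'a) \<Rightarrow>
    'a \<times> 'a \<times> 'a \<Rightarrow> 'a \<times> 'a \<times> 'a" where
  "koszul1 A B C = (\<lambda>(x1, x2, x3). (A x2 - B x1, A x3 - C x1, B x3 - C x2))"

definition koszul2 :: "('a::complex_hilbert \<Rightarrow> 'a) \<Rightarrow> ('a \<Rightarrow> 'a) \<Rightarrow> ('a \<Rightarrow> 'a) \<Rightarrow>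
    'a \<times> 'a \<times> 'a \<Rightarrow> 'a" where
  "koszul2 A B C = (\<lambda>(y12, y13, y23). A y23 - B y13 + C y12)"

definition koszul_exact_on ::
  "'a::complex_hilbert set \<Rightarrow> ('a \<Rightarrow> 'a) \<Rightarrow> ('a \<Rightarrow> 'a) \<Rightarrow> ('a \<Rightarrow> 'a) \<Rightarrow> bool" where
  "koszul_exact_on M A B C \<longleftrightarrow>
     {x \<in> M. koszul0 A B C x = 0} = {0} \<and>
     {v \<in> M \<times> M \<times> M. koszul1 A B C v = 0} = koszul0 A B C ` M \<and>
     {v \<in> M \<times> M \<times> M. koszul2 A B C v = 0} = koszul1 A B C ` (M \<times> M \<times> M) \<and>
     koszul2 A B C ` (M \<times> M \<times> M) = M"

definition taylor_spectrum_on :: "'a::complex_hilbert set \<Rightarrow>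
    ('a \<Rightarrow> 'a) \<Rightarrow> ('a \<Rightarrow> 'a) \<Rightarrow> ('a \<Rightarrow> 'a) \<Rightarrow> (complex \<times> complex \<times> complex) set" where
  "taylor_spectrum_on M A B C = {(a, b, c). \<not> koszul_exact_on M
     (\<lambda>x. A x - a *\<^sub>C x) (\<lambda>x. B x - b *\<^sub>C x) (\<lambda>x. C x - c *\<^sub>C x)}"


section \<open>Spectral sets\<close>

text \<open>Polynomials in three variables: the monomial with exponents \<open>i, j, k\<close> is the key
  \<open>(i, j, k)\<close>.\<close>

type_synonym poly3 = "(nat \<times> nat \<times> nat) \<Rightarrow>\<^sub>0 complex"

definition poly3_eval :: "poly3 \<Rightarrow> complex \<times> complex \<times> complex \<Rightarrow> complex" where
  "poly3_eval p = (\<lambda>(a, b, c). \<Sum>(i, j, k)\<in>Poly_Mapping.keys p.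
     Poly_Mapping.lookup p (i, j, k) * a ^ i * b ^ j * c ^ k)"

definition poly3_op :: "poly3 \<Rightarrow> ('a::complex_hilbert \<Rightarrow> 'a) \<Rightarrow> ('a \<Rightarrow> 'a) \<Rightarrow> ('a \<Rightarrow> 'a) \<Rightarrow> 'a \<Rightarrow> 'a" where
  "poly3_op p A B C x = (\<Sum>(i, j, k)\<in>Poly_Mapping.keys p.
     Poly_Mapping.lookup p (i, j, k) *\<^sub>C (A ^^ i) ((B ^^ j) ((C ^^ k) x)))"

text \<open>\<open>p(T) q(T)^-1\<close> as an operator on \<open>M\<close>. When \<open>q\<close> has no zero on the Taylor spectrum,
  \<open>q(T)\<close> is invertible on \<open>M\<close>, and \<open>inv_into\<close> is its genuine inverse.\<close>

definition rational3_op_on :: "'a::complex_hilbert set \<Rightarrow> poly3 \<Rightarrow> poly3 \<Rightarrow>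
    ('a \<Rightarrow> 'a) \<Rightarrow> ('a \<Rightarrow> 'a) \<Rightarrow> ('a \<Rightarrow> 'a) \<Rightarrow> 'a \<Rightarrow> 'a" where
  "rational3_op_on M p q A B C x = poly3_op p A B C (inv_into M (poly3_op q A B C) x)"

definition spectral_set_on :: "'a::complex_hilbert set \<Rightarrow> (complex \<times> complex \<times> complex) set \<Rightarrow>
    ('a \<Rightarrow> 'a) \<Rightarrow> ('a \<Rightarrow> 'a) \<Rightarrow> ('a \<Rightarrow> 'a) \<Rightarrow> bool" where
  "spectral_set_on M K A B C \<longleftrightarrow> compact K \<and> taylor_spectrum_on M A B C \<subseteq> K \<and>
     (\<forall>p q. (\<forall>z\<in>K. poly3_eval q z \<noteq> 0) \<longrightarrow>
        op_norm_le_on M (rational3_op_on M p q A B C)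
          (SUP z\<in>K. cmod (poly3_eval p z / poly3_eval q z)))"


section \<open>The tetrablock and its operator classes\<close>

definition tetrablock :: "(complex \<times> complex \<times> complex) set" where
  "tetrablock = {(x1, x2, x3). \<forall>z\<in>cball 0 1. \<forall>w\<in>cball 0 1. 1 - z * x1 - w * x2 + z * w * x3 \<noteq> 0}"

definition b_tetrablock :: "(complex \<times> complex \<times> complex) set" where
  "b_tetrablock = {(a, b, p). (a, b, p) \<in> closure tetrablock \<and> cmod p = 1}"

definition E_contraction_on ::
  "'a::complex_hilbert set \<Rightarrow> ('a \<Rightarrow> 'a) \<Rightarrow> ('a \<Rightarrow> 'a) \<Rightarrow> ('a \<Rightarrow> 'a) \<Rightarrow> bool" where
  "E_contraction_on M A B P \<longleftrightarrow>
     commuting_triple_on M A B P \<and> spectral_set_on M (closure tetrablock) A B P"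

definition E_unitary_on ::
  "'a::complex_hilbert set \<Rightarrow> ('a \<Rightarrow> 'a) \<Rightarrow> ('a \<Rightarrow> 'a) \<Rightarrow> ('a \<Rightarrow> 'a) \<Rightarrow> bool" where
  "E_unitary_on M A B P \<longleftrightarrow> commuting_triple_on M A B P \<and>
     normal_on M A \<and> normal_on M B \<and> normal_on M P \<and>
     taylor_spectrum_on M A B P \<subseteq> b_tetrablock"

definition cnu_E_contraction_on ::
  "'a::complex_hilbert set \<Rightarrow> ('a \<Rightarrow> 'a) \<Rightarrow> ('a \<Rightarrow> 'a) \<Rightarrow> ('a \<Rightarrow> 'a) \<Rightarrow> bool" where
  "cnu_E_contraction_on M A B P \<longleftrightarrow> E_contraction_on M A B P \<and> cnu_on M P"

definition pure_E_contraction_on ::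
  "'a::complex_hilbert set \<Rightarrow> ('a \<Rightarrow> 'a) \<Rightarrow> ('a \<Rightarrow> 'a) \<Rightarrow> ('a \<Rightarrow> 'a) \<Rightarrow> bool" where
  "pure_E_contraction_on M A B P \<longleftrightarrow> E_contraction_on M A B P \<and> pure_on M P"


subsection \<open>Square-summable sequences\<close>

typedef (overloaded) 'a ell2 = "{f :: nat \<Rightarrow> 'a::complex_hilbert. summable (\<lambda>n. (norm (f n))\<^sup>2)}"
  morphisms ell2_nth Abs_ell2
  by (rule exI[of _ "\<lambda>_. 0"]) simp

setup_lifting type_definition_ell2

lemma ell2_summable_add:
  fixes f g :: "nat \<Rightarrow> 'a::complex_hilbert"
  assumes "summable (\<lambda>n. (norm (f n))\<^sup>2)" "summable (\<lambda>n. (norm (g n))\<^sup>2)"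
  shows "summable (\<lambda>n. (norm (f n + g n))\<^sup>2)"
proof (rule summable_comparison_test')
  show "summable (\<lambda>n. 2 * (norm (f n))\<^sup>2 + 2 * (norm (g n))\<^sup>2)"
    by (intro summable_add summable_mult assms)
  show "norm ((norm (f n + g n))\<^sup>2) \<le> 2 * (norm (f n))\<^sup>2 + 2 * (norm (g n))\<^sup>2" for n
  proof -
    have "(norm (f n + g n))\<^sup>2 \<le> (norm (f n) + norm (g n))\<^sup>2"
      by (intro power_mono norm_triangle_ineq norm_ge_zero)
    also have "\<dots> \<le> 2 * (norm (f n))\<^sup>2 + 2 * (norm (g n))\<^sup>2"
      using sum_squares_bound[of "norm (f n)" "norm (g n)"] by (simp add: power2_sum)
    finally show ?thesis by simp
  qed
qed

lemma norm_scaleC: "norm (c *\<^sub>C x) = cmod c * norm (x::'a::complex_hilbert)"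
proof -
  have im0: "cinner x x = of_real (inner x x)"
    using cinner_commute[of x x] Re_cinner[of x x] by (simp add: complex_eq_iff)
  have "cinner (c *\<^sub>C x) (c *\<^sub>C x) = c * cnj c * cinner x x"
    using cinner_commute[of x "c *\<^sub>C x"] cinner_commute[of x x]
    by (simp add: cinner_scaleC_left)
  also have "\<dots> = of_real ((cmod c)\<^sup>2 * inner x x)"
    by (metis complex_norm_square im0 of_real_mult)
  finally have "inner (c *\<^sub>C x) (c *\<^sub>C x) = (cmod c)\<^sup>2 * inner x x"
    using Re_cinner by (metis Re_complex_of_real)
  thus ?thesis by (simp add: norm_eq_sqrt_inner real_sqrt_mult)
qed

lemma cmod_cinner_le: "cmod (cinner x y) \<le> norm x * norm (y::'a::complex_hilbert)"
proof -
  obtain u where u: "cmod u = 1" "u * cinner x y = of_real (cmod (cinner x y))"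
  proof (cases "cinner x y = 0")
    case True
    then show ?thesis using that[of 1] by simp
  next
    case False
    then show ?thesis
      using that[of "cnj (cinner x y) / of_real (cmod (cinner x y))"] complex_norm_square[of "cinner x y"]
      by (simp add: norm_divide field_simps power2_eq_square)
  qed
  have "cmod (cinner x y) = inner (u *\<^sub>C x) y"
    using u(2) Re_cinner[of "u *\<^sub>C x" y] by (simp add: cinner_scaleC_left)
  also have "\<dots> \<le> norm (u *\<^sub>C x) * norm y" by (rule norm_cauchy_schwarz)
  finally show ?thesis using u(1) by (simp add: norm_scaleC)
qed

lemma ell2_summable_cinner:
  fixes f g :: "nat \<Rightarrow> 'a::complex_hilbert"
  assumes "summable (\<lambda>n. (norm (f n))\<^sup>2)" "summable (\<lambda>n. (norm (g n))\<^sup>2)"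
  shows "summable (\<lambda>n. cinner (f n) (g n))"
proof (rule summable_comparison_test')
  show "summable (\<lambda>n. (norm (f n))\<^sup>2 + (norm (g n))\<^sup>2)"
    by (intro summable_add assms)
  show "norm (cinner (f n) (g n)) \<le> (norm (f n))\<^sup>2 + (norm (g n))\<^sup>2" for n
  proof -
    have "norm (f n) * norm (g n) \<le> (norm (f n))\<^sup>2 + (norm (g n))\<^sup>2"
      using sum_squares_bound[of "norm (f n)" "norm (g n)"]
        mult_nonneg_nonneg[OF norm_ge_zero[of "f n"] norm_ge_zero[of "g n"]]
      by linarith
    thus ?thesis using cmod_cinner_le[of "f n" "g n"] by linarith
  qed
qed

lemma ell2_summable_inner:
  fixes f g :: "nat \<Rightarrow> 'a::complex_hilbert"
  assumes "summable (\<lambda>n. (norm (f n))\<^sup>2)" "summable (\<lambda>n. (norm (g n))\<^sup>2)"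
  shows "summable (\<lambda>n. inner (f n) (g n))"
  using summable_Re[OF ell2_summable_cinner[OF assms]] by (simp add: Re_cinner)

instantiation ell2 :: (complex_hilbert) real_vector
begin

lift_definition zero_ell2 :: "'a ell2" is "\<lambda>_. 0" by simp
lift_definition plus_ell2 :: "'a ell2 \<Rightarrow> 'a ell2 \<Rightarrow> 'a ell2" is "\<lambda>f g n. f n + g n"
  by (rule ell2_summable_add)
lift_definition uminus_ell2 :: "'a ell2 \<Rightarrow> 'a ell2" is "\<lambda>f n. - f n" by simp
lift_definition minus_ell2 :: "'a ell2 \<Rightarrow> 'a ell2 \<Rightarrow> 'a ell2" is "\<lambda>f g n. f n - g n"
  using ell2_summable_add[of _ "\<lambda>n. - _ n"] by simp
lift_definition scaleR_ell2 :: "real \<Rightarrow> 'a ell2 \<Rightarrow> 'a ell2" is "\<lambda>r f n. r *\<^sub>R f n"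
  by (simp add: power_mult_distrib summable_mult)

instance
  by standard (transfer; simp add: algebra_simps)+

end

instantiation ell2 :: (complex_hilbert) real_inner
begin

lift_definition inner_ell2 :: "'a ell2 \<Rightarrow> 'a ell2 \<Rightarrow> real" is "\<lambda>f g. suminf (\<lambda>n. inner (f n) (g n))" .

definition norm_ell2 :: "'a ell2 \<Rightarrow> real" where "norm_ell2 x = sqrt (inner x x)"
definition sgn_ell2 :: "'a ell2 \<Rightarrow> 'a ell2" where "sgn_ell2 x = x /\<^sub>R norm x"
definition dist_ell2 :: "'a ell2 \<Rightarrow> 'a ell2 \<Rightarrow> real" where "dist_ell2 x y = norm (x - y)"
definition uniformity_ell2 :: "('a ell2 \<times> 'a ell2) filter" where
  "uniformity_ell2 = (INF e\<in>{0<..}. principal {(x, y). dist x y < e})"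
definition open_ell2 :: "'a ell2 set \<Rightarrow> bool" where
  "open_ell2 U = (\<forall>x\<in>U. eventually (\<lambda>(x', y). x' = x \<longrightarrow> y \<in> U) uniformity)"

instance
proof
  fix x y z :: "'a ell2" and r :: real and U :: "'a ell2 set"
  show "dist x y = norm (x - y)" by (rule dist_ell2_def)
  show "sgn x = x /\<^sub>R norm x" by (rule sgn_ell2_def)
  show "uniformity = (INF e\<in>{0<..}. principal {(x::'a ell2, y). dist x y < e})"
    by (rule uniformity_ell2_def)
  show "open U = (\<forall>x\<in>U. eventually (\<lambda>(x', y). x' = x \<longrightarrow> y \<in> U) uniformity)"
    by (rule open_ell2_def)
  show "norm x = sqrt (inner x x)" by (rule norm_ell2_def)
  show "inner x y = inner y x" by transfer (simp add: inner_commute)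
  show "inner (x + y) z = inner x z + inner y z"
    by transfer (simp add: inner_add_left suminf_add ell2_summable_inner)
  show "inner (r *\<^sub>R x) y = r * inner x y"
    by transfer (simp add: suminf_mult ell2_summable_inner)
  show "0 \<le> inner x x"
    by transfer (simp add: suminf_nonneg ell2_summable_inner)
  show "inner x x = 0 \<longleftrightarrow> x = 0"
  proof (transfer, goal_cases)
    case (1 f)
    have "suminf (\<lambda>n. inner (f n) (f n)) = 0 \<longleftrightarrow> (\<forall>n. inner (f n) (f n) = 0)"
      by (rule suminf_eq_zero_iff) (use 1 ell2_summable_inner in auto)
    thus ?case by (auto simp: fun_eq_iff)
  qed
qed

end

lemma norm_ell2_sq: "(norm x)\<^sup>2 = suminf (\<lambda>n. (norm (ell2_nth x n))\<^sup>2)"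
  unfolding power2_norm_eq_inner by transfer simp

lemma ell2_nth_summable: "summable (\<lambda>n. (norm (ell2_nth x n))\<^sup>2)"
  using ell2_nth[of x] by simp

lemma sum_ell2_le_norm: "(\<Sum>n<k. (norm (ell2_nth x n))\<^sup>2) \<le> (norm x)\<^sup>2"
  unfolding norm_ell2_sq by (rule sum_le_suminf[OF ell2_nth_summable]) auto

lemma norm_ell2_nth_le: "norm (ell2_nth x n) \<le> norm x"
proof -
  have "(norm (ell2_nth x n))\<^sup>2 \<le> (\<Sum>k<Suc n. (norm (ell2_nth x k))\<^sup>2)"
    by (simp add: sum_nonneg)
  also have "\<dots> \<le> (norm x)\<^sup>2" by (rule sum_ell2_le_norm)
  finally show ?thesis by (rule power2_le_imp_le) simp
qed

instance ell2 :: (complex_hilbert) banach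
proof
  fix X :: "nat \<Rightarrow> 'a ell2"
  assume X: "Cauchy X"
  have "Cauchy (\<lambda>m. ell2_nth (X m) n)" for n
  proof (rule CauchyI)
    fix e :: real assume "0 < e"
    then obtain N where N: "\<And>m k. m \<ge> N \<Longrightarrow> k \<ge> N \<Longrightarrow> norm (X m - X k) < e"
      using CauchyD[OF X] by blast
    have "norm (ell2_nth (X m) n - ell2_nth (X k) n) < e" if "m \<ge> N" "k \<ge> N" for m k
      using norm_ell2_nth_le[of "X m - X k" n] N[OF that] by (simp add: minus_ell2.rep_eq)
    thus "\<exists>M. \<forall>m\<ge>M. \<forall>k\<ge>M. norm (ell2_nth (X m) n - ell2_nth (X k) n) < e" by blast
  qed
  then obtain l where l: "\<And>n. (\<lambda>m. ell2_nth (X m) n) \<longlonglongrightarrow> l n"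
    unfolding Cauchy_convergent_iff convergent_def by metis
  have bound: "(\<Sum>n<j. (norm (ell2_nth (X m) n - l n))\<^sup>2) \<le> e\<^sup>2"
    if "\<And>k. k \<ge> N \<Longrightarrow> norm (X m - X k) \<le> e" for m j N and e :: real
  proof (rule LIMSEQ_le_const2)
    show "(\<lambda>k. \<Sum>n<j. (norm (ell2_nth (X m) n - ell2_nth (X k) n))\<^sup>2)
            \<longlonglongrightarrow> (\<Sum>n<j. (norm (ell2_nth (X m) n - l n))\<^sup>2)"
      by (intro tendsto_intros l)
    have "(\<Sum>n<j. (norm (ell2_nth (X m) n - ell2_nth (X k) n))\<^sup>2) \<le> e\<^sup>2" if "k \<ge> N" for k
      using sum_ell2_le_norm[of "X m - X k" j] power_mono[OF \<open>\<And>k. k \<ge> N \<Longrightarrow> norm (X m - X k) \<le> e\<close>[OF that], of 2]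
      by (simp add: minus_ell2.rep_eq)
    thus "\<exists>M. \<forall>k\<ge>M. (\<Sum>n<j. (norm (ell2_nth (X m) n - ell2_nth (X k) n))\<^sup>2) \<le> e\<^sup>2" by blast
  qed
  have summ: "summable (\<lambda>n. (norm (ell2_nth (X m) n - l n))\<^sup>2)"
    and le: "suminf (\<lambda>n. (norm (ell2_nth (X m) n - l n))\<^sup>2) \<le> e\<^sup>2"
    if "\<And>k. k \<ge> N \<Longrightarrow> norm (X m - X k) \<le> e" for m N and e :: real
  proof -
    show s: "summable (\<lambda>n. (norm (ell2_nth (X m) n - l n))\<^sup>2)"
      by (rule summableI_nonneg_bounded[where x = "e\<^sup>2"]) (use bound[OF that] in auto)
    show "suminf (\<lambda>n. (norm (ell2_nth (X m) n - l n))\<^sup>2) \<le> e\<^sup>2"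
      by (rule suminf_le_const[OF s bound[OF that]])
  qed
  obtain N1 where N1: "\<And>m k. m \<ge> N1 \<Longrightarrow> k \<ge> N1 \<Longrightarrow> norm (X m - X k) < 1"
    using CauchyD[OF X, of 1] by auto
  have "summable (\<lambda>n. (norm (ell2_nth (X N1) n - l n))\<^sup>2)"
    using summ[of N1 N1 1] N1[of N1] by force
  hence "summable (\<lambda>n. (norm (- (ell2_nth (X N1) n - l n) + ell2_nth (X N1) n))\<^sup>2)"
    by (intro ell2_summable_add ell2_nth_summable) (simp add: norm_minus_commute)
  hence "summable (\<lambda>n. (norm (l n))\<^sup>2)" by simp
  then obtain L where L: "ell2_nth L = l"
    by (metis Abs_ell2_inverse mem_Collect_eq)
  have "X \<longlonglongrightarrow> L"
  proof (rule LIMSEQ_I)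
    fix e :: real assume "0 < e"
    then obtain N where N: "\<And>m k. m \<ge> N \<Longrightarrow> k \<ge> N \<Longrightarrow> norm (X m - X k) < e / 2"
      using CauchyD[OF X, of "e / 2"] by auto
    have "norm (X m - L) < e" if "m \<ge> N" for m
    proof -
      have "(norm (X m - L))\<^sup>2 \<le> (e / 2)\<^sup>2"
        using le[of N m "e / 2"] N[OF that] by (force simp: norm_ell2_sq minus_ell2.rep_eq L)
      hence "norm (X m - L) \<le> e / 2" by (rule power2_le_imp_le) (use \<open>0 < e\<close> in simp)
      thus ?thesis using \<open>0 < e\<close> by simp
    qed
    thus "\<exists>no. \<forall>n\<ge>no. norm (X n - L) < e" by blast
  qed
  thus "convergent X" by (rule convergentI)
qed

instantiation ell2 :: (complex_hilbert) complex_hilbert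
begin

lift_definition scaleC_ell2 :: "complex \<Rightarrow> 'a ell2 \<Rightarrow> 'a ell2" is "\<lambda>c f n. c *\<^sub>C f n"
  by (simp add: norm_scaleC power_mult_distrib summable_mult)

lift_definition cinner_ell2 :: "'a ell2 \<Rightarrow> 'a ell2 \<Rightarrow> complex" is
  "\<lambda>f g. suminf (\<lambda>n. cinner (f n) (g n))" .

instance
proof
  fix x y z :: "'a ell2" and c d :: complex and r :: real
  show "c *\<^sub>C (x + y) = c *\<^sub>C x + c *\<^sub>C y" by transfer (simp add: scaleC_add_right)
  show "(c + d) *\<^sub>C x = c *\<^sub>C x + d *\<^sub>C x" by transfer (simp add: scaleC_add_left)
  show "c *\<^sub>C d *\<^sub>C x = (c * d) *\<^sub>C x" by transfer (simp add: scaleC_scaleC)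
  show "of_real r *\<^sub>C x = r *\<^sub>R x" by transfer (simp add: scaleC_of_real)
  show "cinner x y = cnj (cinner y x)"
  proof (transfer, goal_cases)
    case (1 f g)
    have "(\<lambda>n. cnj (cinner (g n) (f n))) sums cnj (suminf (\<lambda>n. cinner (g n) (f n)))"
      using ell2_summable_cinner[of g f] 1 by (simp add: sums_cnj summable_sums)
    hence "(\<lambda>n. cinner (f n) (g n)) sums cnj (suminf (\<lambda>n. cinner (g n) (f n)))"
      by (simp only: cinner_commute[symmetric])
    thus ?case by (rule sums_unique[symmetric])
  qed
  show "cinner (x + y) z = cinner x z + cinner y z"
    by transfer (simp add: cinner_add_left suminf_add ell2_summable_cinner)
  show "cinner (c *\<^sub>C x) y = c * cinner x y"
    by transfer (simp add: cinner_scaleC_left suminf_mult ell2_summable_cinner)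
  show "Re (cinner x y) = inner x y"
    by transfer (simp add: Re_suminf ell2_summable_cinner Re_cinner)
qed

end


subsection \<open>E-isometries\<close>

text \<open>The triple on \<open>M\<close> is, via the isometric embedding \<open>J\<close>, the restriction of an E-unitary on
  a Hilbert space \<open>K\<close> to the joint invariant subspace \<open>J ` M\<close>. Types cannot be quantified
  existentially, so \<open>K\<close> is taken to be a closed subspace of \<open>ell2\<close> over the type of \<open>M\<close>. This loses
  no generality: \<open>K\<close> may always be cut down to the smallest subspace reducing the E-unitary and
  containing \<open>J ` M\<close>, which is the closed linear span of the images of \<open>J ` M\<close> under countably many
  bounded operators and hence embeds isometrically in \<open>ell2\<close>.\<close>

definition E_isometry_on ::
  "'a::complex_hilbert set \<Rightarrow> ('a \<Rightarrow> 'a) \<Rightarrow> ('a \<Rightarrow> 'a) \<Rightarrow> ('a \<Rightarrow> 'a) \<Rightarrow> bool" where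
  "E_isometry_on M A B P \<longleftrightarrow> commuting_triple_on M A B P \<and>
     (\<exists>(K :: 'a ell2 set) A' B' P' J.
        E_unitary_on K A' B' P' \<and>
        J ` M \<subseteq> K \<and>
        (\<forall>x\<in>M. \<forall>y\<in>M. J (x + y) = J x + J y) \<and>
        (\<forall>c. \<forall>x\<in>M. J (c *\<^sub>C x) = c *\<^sub>C J x) \<and>
        (\<forall>x\<in>M. norm (J x) = norm x) \<and>
        (\<forall>x\<in>M. J (A x) = A' (J x) \<and> J (B x) = B' (J x) \<and> J (P x) = P' (J x)))"

definition cnu_E_isometry_on ::
  "'a::complex_hilbert set \<Rightarrow> ('a \<Rightarrow> 'a) \<Rightarrow> ('a \<Rightarrow> 'a) \<Rightarrow> ('a \<Rightarrow> 'a) \<Rightarrow> bool" where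
  "cnu_E_isometry_on M A B P \<longleftrightarrow> E_isometry_on M A B P \<and> cnu_on M P"


section \<open>The decomposition determined by a c.n.u. contraction\<close>

text \<open>For a contraction \<open>P\<close>, the first and third set are mutually orthogonal closed subspaces
  (\<open>x\<close> lies in the third one iff \<open>P*^k P^k x = x\<close> for all \<open>k\<close>), so the three sets do form an
  orthogonal decomposition of the whole space.\<close>

definition decomp_H1 :: "('a::complex_hilbert \<Rightarrow> 'a) \<Rightarrow> 'a set" where
  "decomp_H1 P = {x. (\<lambda>k. norm ((P ^^ k) x)) \<longlonglongrightarrow> 0}"

definition decomp_H3 :: "('a::complex_hilbert \<Rightarrow> 'a) \<Rightarrow> 'a set" where
  "decomp_H3 P = {x. (\<lambda>k. norm ((P ^^ k) x)) \<longlonglongrightarrow> norm x}"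

definition decomp_H2 :: "('a::complex_hilbert \<Rightarrow> 'a) \<Rightarrow> 'a set" where
  "decomp_H2 P = orth_compl {x + y | x y. x \<in> decomp_H1 P \<and> y \<in> decomp_H3 P}"

end

theory Submission
  imports Defs
begin

text \<open>
  A contraction \<open>P\<close> determines \<open>decomp_H1 P\<close> as the kernel and \<open>decomp_H3 P\<close> as the fixed space of the
  strong limit of \<open>P\<^sup>*\<^sup>k P\<^sup>k\<close>. The hypotheses say that \<open>A\<close>, \<open>B\<close>, \<open>A\<^sup>*\<close>, \<open>B\<^sup>*\<close> all commute with \<open>P\<close>, hence with
  these operators, and the invariance claims follow (\<open>decomp_H1_invariant\<close>, \<open>decomp_H3_invariant\<close>,
  \<open>adj_orth_compl_invariant\<close>).

  What remains for the first two summands is that E-contractions are stable under restriction to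
  joint invariant subspaces and under taking adjoints. The definition obstructs this, since it
  speaks of inverses \<open>q(T)\<^sup>-\<^sup>1\<close> and of the Taylor spectrum. The key step, \<open>E_contraction_on_iff\<close>,
  shows that a commuting triple \<open>T\<close> is an E-contraction if and only if
  \<open>\<parallel>p(T) x\<parallel> \<le> sup \<bar>p / q\<bar> \<parallel>q(T) x\<parallel>\<close> for all \<open>x\<close>, all polynomials \<open>p\<close> and all \<open>q\<close> without zeros on the
  closed tetrablock \<open>K\<close>. The case \<open>p = 1\<close> bounds \<open>q(T)\<close> from below. Surjectivity follows by
  continuation: \<open>q\<^sub>r(a, b, c) = q(r a, r b, r\<^sup>2 c)\<close>, \<open>0 \<le> r \<le> 1\<close>, joins a nonzero constant to \<open>q\<close>, and as
  these dilations map \<open>K\<close> into itself the lower bound is uniform in \<open>r\<close>. The spectrum is controlled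
  by \<open>von_neumann_taylor_spectrum\<close>: a point outside \<open>K\<close> is a zero of an affine polynomial without
  zeros on \<open>K\<close>, and an invertible linear combination of the entries makes a Koszul complex exact.
  In this form restriction is trivial, and adjoints are handled by duality.

  On \<open>decomp_H3 P\<close> the operator \<open>P\<close> is isometric. The inequalities \<open>\<parallel>(A - z P) x\<parallel> \<le> \<parallel>(1 - z B) x\<parallel>\<close> and
  \<open>\<parallel>(B - z P) x\<parallel> \<le> \<parallel>(1 - z A) x\<parallel>\<close> for \<open>\<bar>z\<bar> = 1\<close> then force \<open>A\<^sup>*P = B\<close> and \<open>B\<^sup>*P = A\<close>. Since \<open>P\<close> commutes with
  \<open>A\<^sup>*\<close> and \<open>B\<^sup>*\<close>, the ranges of \<open>A = P B\<^sup>*\<close> and \<open>B = P A\<^sup>*\<close> lie in the range of \<open>P\<close>, so \<open>A\<^sup>*\<close> and \<open>B\<^sup>*\<close>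
  kill its orthogonal complement. Then \<open>P\<close> maps the closures of the ranges of \<open>A\<^sup>*\<close> and \<open>B\<^sup>*\<close> onto
  themselves, which is impossible for a c.n.u. isometry unless \<open>A = B = 0\<close> there
  (\<open>E_contraction_cnu_isometry_zero\<close>). So the third summand is \<open>(0, 0, V)\<close> with an isometry \<open>V\<close>, and it
  extends to the E-unitary \<open>(0, 0, U)\<close>, where \<open>U\<close> is a unitary extension of \<open>V\<close>.
\<close>


section \<open>Complex Hilbert spaces and closed subspaces\<close>

interpretation scaleC: vector_space "scaleC :: complex \<Rightarrow> 'a::complex_hilbert \<Rightarrow> 'a"
proof
  show "1 *\<^sub>C x = x" for x :: 'a
    using scaleC_of_real[of 1 x] by simp
qed (simp_all add: scaleC_add_right scaleC_add_left scaleC_scaleC)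

lemma scaleC_scaleR_commute: "c *\<^sub>C (r *\<^sub>R x) = r *\<^sub>R (c *\<^sub>C x)"
  by (simp add: scaleC_of_real[symmetric] scaleC_scaleC mult.commute)

lemma bounded_linear_scaleC: "bounded_linear (scaleC c :: 'a::complex_hilbert \<Rightarrow> 'a)"
  by (rule bounded_linear_intro[where K = "cmod c"])
    (simp_all add: scaleC_add_right scaleC_scaleR_commute norm_scaleC mult.commute)

lemma cinner_scaleC_right: "cinner x (c *\<^sub>C y) = cnj c * cinner x y"
  by (metis cinner_commute cinner_scaleC_left complex_cnj_mult)

lemma cinner_add_right: "cinner x (y + z) = cinner x y + cinner x z"
  by (metis cinner_add_left cinner_commute complex_cnj_add)

lemma cinner_scaleR_left: "cinner (r *\<^sub>R x) y = of_real r * cinner x y"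
  by (simp add: scaleC_of_real[symmetric] cinner_scaleC_left)

lemma cinner_zero_left [simp]: "cinner 0 x = 0"
  using cinner_scaleC_left[of 0 0 x] by simp

lemma cinner_zero_right [simp]: "cinner x 0 = 0"
  using cinner_scaleC_right[of x 0 0] by simp

lemma cinner_diff_left: "cinner (x - y) z = cinner x z - cinner y z"
  using cinner_add_left[of "x - y" y z] by simp

lemma cinner_diff_right: "cinner x (y - z) = cinner x y - cinner x z"
  using cinner_add_right[of x "y - z" z] by simp

lemma cinner_sum_left: "cinner (sum f I) x = (\<Sum>i\<in>I. cinner (f i) x)"
  by (induction I rule: infinite_finite_induct) (simp_all add: cinner_add_left)

lemma cinner_sum_right: "cinner x (sum f I) = (\<Sum>i\<in>I. cinner x (f i))"
  by (induction I rule: infinite_finite_induct) (simp_all add: cinner_add_right)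

lemma cinner_self: "cinner x x = of_real ((norm x)\<^sup>2)"
  using cinner_commute[of x x] Re_cinner[of x x]
  by (simp add: complex_eq_iff power2_norm_eq_inner)

lemma cinner_self_eq_0_iff [simp]: "cinner x x = 0 \<longleftrightarrow> x = 0"
  by (simp add: cinner_self)

lemma norm_add_sq: "(norm (x + y))\<^sup>2 = (norm x)\<^sup>2 + (norm y)\<^sup>2 + 2 * Re (cinner x y)"
  by (simp add: power2_norm_eq_inner Re_cinner inner_add_left inner_add_right inner_commute)

lemma norm_diff_sq: "(norm (x - y))\<^sup>2 = (norm x)\<^sup>2 + (norm y)\<^sup>2 - 2 * Re (cinner x y)"
  by (simp add: power2_norm_eq_inner Re_cinner inner_diff_left inner_diff_right inner_commute)

lemma csubspace_zero: "closed_csubspace M \<Longrightarrow> 0 \<in> M"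
  and csubspace_add: "closed_csubspace M \<Longrightarrow> x \<in> M \<Longrightarrow> y \<in> M \<Longrightarrow> x + y \<in> M"
  and csubspace_scaleC: "closed_csubspace M \<Longrightarrow> x \<in> M \<Longrightarrow> c *\<^sub>C x \<in> M"
  and csubspace_closed: "closed_csubspace M \<Longrightarrow> closed M"
  by (auto simp: closed_csubspace_def)

lemma csubspace_minus: "closed_csubspace M \<Longrightarrow> x \<in> M \<Longrightarrow> - x \<in> M"
  using csubspace_scaleC[of M x "-1"] by simp

lemma csubspace_diff: "closed_csubspace M \<Longrightarrow> x \<in> M \<Longrightarrow> y \<in> M \<Longrightarrow> x - y \<in> M"
  using csubspace_add[of M x "- y"] csubspace_minus[of M y] by simp

lemma cinner_eqI:
  assumes M: "closed_csubspace M" "u \<in> M" "v \<in> M"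
    and eq: "\<And>x. x \<in> M \<Longrightarrow> cinner x u = cinner x v"
  shows "u = v"
proof -
  have "cinner (u - v) (u - v) = 0"
    using eq[OF csubspace_diff[OF M]] by (simp add: cinner_diff_right)
  thus ?thesis by simp
qed

lemma csubspace_scaleR: "closed_csubspace M \<Longrightarrow> x \<in> M \<Longrightarrow> r *\<^sub>R x \<in> M"
  using csubspace_scaleC[of M x "of_real r"] by (simp add: scaleC_of_real)

lemma csubspace_sum: "closed_csubspace M \<Longrightarrow> (\<And>i. i \<in> I \<Longrightarrow> f i \<in> M) \<Longrightarrow> sum f I \<in> M"
  by (induction I rule: infinite_finite_induct) (auto intro: csubspace_zero csubspace_add)

lemma continuous_cinner_left: "continuous_on UNIV (\<lambda>x. cinner x (y::'a::complex_hilbert))"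
proof -
  have "bounded_linear (\<lambda>x. cinner x y)"
    by (rule bounded_linear_intro[where K = "norm y"])
      (auto simp: cinner_add_left scaleC_of_real[symmetric] cinner_scaleC_left scaleR_conv_of_real
        cmod_cinner_le)
  thus ?thesis by (simp add: linear_continuous_on)
qed

lemma csubspace_orth_compl: "closed_csubspace (orth_compl S)"
proof -
  have "orth_compl S = (\<Inter>y\<in>S. {x. cinner x y = 0})" by (auto simp: orth_compl_def)
  moreover have "closed {x. cinner x y = 0}" for y :: 'a
    by (rule closed_Collect_eq) (auto intro: continuous_cinner_left)
  ultimately have "closed (orth_compl S)" by auto
  thus ?thesis
    by (auto simp: closed_csubspace_def orth_compl_def cinner_add_left cinner_scaleC_left)
qed

text \<open>The representing vector is the minimiser of \<open>\<parallel>x\<parallel>\<^sup>2 - 2 Re (f x)\<close> over \<open>M\<close>: by the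
  parallelogram law every minimising sequence is Cauchy, and the first variation at the minimum
  vanishes. For \<open>f = (\<lambda>x. cinner x y)\<close> the same vector is the orthogonal projection of \<open>y\<close>
  onto \<open>M\<close>.\<close>

theorem riesz_on:
  fixes f :: "'a::complex_hilbert \<Rightarrow> complex"
  assumes M: "closed_csubspace M"
    and add: "\<And>x y. x \<in> M \<Longrightarrow> y \<in> M \<Longrightarrow> f (x + y) = f x + f y"
    and scale: "\<And>c x. x \<in> M \<Longrightarrow> f (c *\<^sub>C x) = c * f x"
    and bound: "\<And>x. x \<in> M \<Longrightarrow> cmod (f x) \<le> K * norm x"
  shows "\<exists>z\<in>M. \<forall>x\<in>M. f x = cinner x z"
proof -
  define J where "J x = (norm x)\<^sup>2 - 2 * Re (f x)" for x
  have diff: "f (x - y) = f x - f y" if "x \<in> M" "y \<in> M" for x y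
    using add[of x "(-1) *\<^sub>C y"] scale[of y "-1"] csubspace_scaleC[OF M that(2), of "-1"] that by simp
  have scaleR: "f (r *\<^sub>R x) = r * f x" if "x \<in> M" for r x
    using scale[OF that, of "of_real r"] by (simp add: scaleC_of_real)
  have below: "- K\<^sup>2 \<le> J x" if "x \<in> M" for x
  proof -
    have "Re (f x) \<le> K * norm x" using bound[OF that] complex_Re_le_cmod order_trans by blast
    moreover have "0 \<le> (norm x - K)\<^sup>2" by simp
    ultimately show ?thesis by (simp add: J_def power2_diff mult.commute)
  qed
  define m where "m = Inf (J ` M)"
  have bdd: "bdd_below (J ` M)" using below by (auto intro!: bdd_belowI2)
  have m_le: "m \<le> J x" if "x \<in> M" for x
    unfolding m_def using that by (intro cInf_lower bdd) auto
  have "\<exists>x\<in>M. J x < m + 1 / Suc n" for n :: nat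
  proof -
    have "J ` M \<noteq> {}" using csubspace_zero[OF M] by auto
    moreover have "Inf (J ` M) < m + 1 / Suc n" unfolding m_def by simp
    ultimately have "\<exists>y\<in>J ` M. y < m + 1 / Suc n" by (rule cInf_lessD)
    thus ?thesis by auto
  qed
  then obtain X where X: "\<And>n::nat. X n \<in> M" "\<And>n. J (X n) < m + 1 / Suc n" by metis
  have close: "(norm (x - y))\<^sup>2 \<le> 2 * (J x - m) + 2 * (J y - m)" if "x \<in> M" "y \<in> M" for x y
  proof -
    let ?h = "(1/2) *\<^sub>R (x + y)"
    have h: "?h \<in> M" by (intro csubspace_scaleR csubspace_add M that)
    have "Re (f ?h) = (Re (f x) + Re (f y)) / 2"
      by (simp only: scaleR[OF csubspace_add[OF M that]] add[OF that]) simp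
    hence "4 * J ?h = (norm (x + y))\<^sup>2 - 4 * (Re (f x) + Re (f y))"
      by (simp add: J_def power2_eq_square)
    moreover have "(norm (x + y))\<^sup>2 + (norm (x - y))\<^sup>2 = 2 * (norm x)\<^sup>2 + 2 * (norm y)\<^sup>2"
      by (simp add: norm_add_sq norm_diff_sq)
    ultimately show ?thesis using m_le[OF h] by (simp add: J_def)
  qed
  have "Cauchy X"
  proof (rule CauchyI)
    fix e :: real assume e: "0 < e"
    obtain N :: nat where N: "4 / e\<^sup>2 < N" using reals_Archimedean2 by blast
    have tail: "J (X n) - m < e\<^sup>2 / 4" if "N \<le> n" for n
    proof -
      have "4 / e\<^sup>2 < real (Suc n)" using N that by linarith
      hence "1 / Suc n < e\<^sup>2 / 4" using e by (simp add: field_simps)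
      thus ?thesis using X(2)[of n] by linarith
    qed
    have "norm (X i - X j) < e" if "N \<le> i" "N \<le> j" for i j
    proof -
      have "(norm (X i - X j))\<^sup>2 \<le> 2 * (J (X i) - m) + 2 * (J (X j) - m)"
        by (rule close[OF X(1) X(1)])
      also have "\<dots> < 2 * (e\<^sup>2 / 4) + 2 * (e\<^sup>2 / 4)"
        by (intro add_strict_mono mult_strict_left_mono tail that) auto
      also have "\<dots> = e\<^sup>2" by simp
      finally have "(norm (X i - X j))\<^sup>2 < e\<^sup>2" .
      thus ?thesis by (rule power2_less_imp_less) (use e in simp)
    qed
    thus "\<exists>N. \<forall>i\<ge>N. \<forall>j\<ge>N. norm (X i - X j) < e" by blast
  qed
  then obtain z where z: "X \<longlonglongrightarrow> z" using Cauchy_convergent_iff convergent_def by blast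
  have zM: "z \<in> M" using closed_sequentially[OF csubspace_closed[OF M] _ z] X(1) by blast
  have "(\<lambda>n. f (X n)) \<longlonglongrightarrow> f z"
  proof (rule LIM_zero_cancel, rule tendsto_0_le[where K = K])
    show "(\<lambda>n. X n - z) \<longlonglongrightarrow> 0" using z by (rule LIM_zero)
    show "\<forall>\<^sub>F n in sequentially. norm (f (X n) - f z) \<le> norm (X n - z) * K"
      using bound[OF csubspace_diff[OF M X(1) zM]] diff[OF X(1) zM] by (simp add: mult.commute)
  qed
  hence "(\<lambda>n. J (X n)) \<longlonglongrightarrow> J z" unfolding J_def by (intro tendsto_intros z)
  moreover have "(\<lambda>n. m + 1 / Suc n) \<longlonglongrightarrow> m + 0"
    by (intro tendsto_intros LIMSEQ_inverse_real_of_nat[unfolded inverse_eq_divide])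
  ultimately have "J z \<le> m + 0"
    by (rule LIMSEQ_le) (use less_imp_le[OF X(2)] in auto)
  hence min: "J z \<le> J x" if "x \<in> M" for x using m_le[OF that] by simp
  have re: "Re (f x) = Re (cinner x z)" if x: "x \<in> M" for x
  proof -
    define d where "d = Re (cinner x z) - Re (f x)"
    have var: "0 \<le> t\<^sup>2 * (norm x)\<^sup>2 + 2 * t * d" for t
    proof -
      have tx: "t *\<^sub>R x \<in> M" by (rule csubspace_scaleR[OF M x])
      have "J (t *\<^sub>R x + z) = J z + (t\<^sup>2 * (norm x)\<^sup>2 + 2 * t * d)"
        unfolding J_def d_def add[OF tx zM] scaleR[OF x] norm_add_sq
        by (simp add: power_mult_distrib cinner_scaleR_left) (simp add: algebra_simps)
      thus ?thesis using min[OF csubspace_add[OF M tx zM]] by linarith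
    qed
    show ?thesis
    proof (rule ccontr)
      assume "Re (f x) \<noteq> Re (cinner x z)"
      hence d: "d \<noteq> 0" by (simp add: d_def)
      define t where "t = - d / ((norm x)\<^sup>2 + 1)"
      have pos: "(norm x)\<^sup>2 + 1 > 0" by (simp add: add_nonneg_pos)
      have "t * ((norm x)\<^sup>2 + 1) = - d" unfolding t_def using pos by simp
      hence "t * (norm x)\<^sup>2 = - d - t" by (simp add: algebra_simps)
      hence "t\<^sup>2 * (norm x)\<^sup>2 = t * (- d - t)" by (simp add: power2_eq_square mult.assoc)
      with var[of t] have "0 \<le> t * d - t\<^sup>2" by (simp add: algebra_simps power2_eq_square)
      moreover have "t * d \<le> 0" unfolding t_def using pos
        by (simp add: divide_nonpos_pos)
      moreover have "t \<noteq> 0" using d pos by (simp add: t_def)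
      ultimately show False using zero_less_power2[of t] by linarith
    qed
  qed
  \<comment> \<open>The imaginary parts are the real parts at \<open>\<i>x\<close>.\<close>
  have "f x = cinner x z" if x: "x \<in> M" for x
    using re[OF x] re[OF csubspace_scaleC[OF M x, of \<i>]] scale[OF x, of \<i>]
    by (simp add: complex_eq_iff cinner_scaleC_left)
  thus ?thesis using zM by blast
qed

lemma orthogonal_projection_exists:
  assumes M: "closed_csubspace M"
  shows "\<exists>z\<in>M. \<forall>x\<in>M. cinner x (y - z) = 0"
proof -
  have "\<exists>z\<in>M. \<forall>x\<in>M. cinner x y = cinner x z"
    by (rule riesz_on[OF M, where K = "norm y"])
      (use cmod_cinner_le in \<open>auto simp: cinner_add_left cinner_scaleC_left mult.commute\<close>)
  thus ?thesis by (auto simp: cinner_diff_right)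
qed


section \<open>Bounded operators on a closed subspace and their adjoints\<close>

lemma bounded_op_onI:
  assumes "closed_csubspace M" "\<And>x. x \<in> M \<Longrightarrow> T x \<in> M"
    and "\<And>x y. x \<in> M \<Longrightarrow> y \<in> M \<Longrightarrow> T (x + y) = T x + T y"
    and "\<And>c x. x \<in> M \<Longrightarrow> T (c *\<^sub>C x) = c *\<^sub>C T x"
    and "\<And>x. x \<in> M \<Longrightarrow> norm (T x) \<le> K * norm x"
  shows "bounded_op_on M T"
  using assms unfolding bounded_op_on_def by blast

context
  fixes M :: "'a::complex_hilbert set" and T :: "'a \<Rightarrow> 'a"
  assumes T: "bounded_op_on M T"
begin

lemma bounded_op_csubspace: "closed_csubspace M"
  and bounded_op_in: "x \<in> M \<Longrightarrow> T x \<in> M"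
  and bounded_op_add: "x \<in> M \<Longrightarrow> y \<in> M \<Longrightarrow> T (x + y) = T x + T y"
  and bounded_op_scaleC: "x \<in> M \<Longrightarrow> T (c *\<^sub>C x) = c *\<^sub>C T x"
  using T by (auto simp: bounded_op_on_def)

lemma bounded_op_zero: "T 0 = 0"
  using bounded_op_scaleC[of 0 0] csubspace_zero[OF bounded_op_csubspace] by simp

lemma bounded_op_minus: "x \<in> M \<Longrightarrow> T (- x) = - T x"
  using bounded_op_scaleC[of x "-1"] by simp

lemma bounded_op_diff: "x \<in> M \<Longrightarrow> y \<in> M \<Longrightarrow> T (x - y) = T x - T y"
  using bounded_op_add[of x "- y"] bounded_op_minus[of y] csubspace_minus[OF bounded_op_csubspace, of y]
  by simp

lemma bounded_op_sum: "(\<And>i. i \<in> I \<Longrightarrow> f i \<in> M) \<Longrightarrow> T (sum f I) = (\<Sum>i\<in>I. T (f i))"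
  by (induction I rule: infinite_finite_induct)
    (auto simp: bounded_op_zero bounded_op_add csubspace_sum[OF bounded_op_csubspace])

lemma bounded_op_bound: obtains K where "0 \<le> K" "\<And>x. x \<in> M \<Longrightarrow> norm (T x) \<le> K * norm x"
proof -
  obtain K where K: "\<And>x. x \<in> M \<Longrightarrow> norm (T x) \<le> K * norm x"
    using T unfolding bounded_op_on_def by blast
  show ?thesis
  proof
    show "norm (T x) \<le> max 0 K * norm x" if "x \<in> M" for x
      using K[OF that] by (rule order_trans) (simp add: mult_right_mono)
  qed simp
qed

lemma bounded_op_tendsto:
  assumes "\<And>n. X n \<in> M" "X \<longlonglongrightarrow> x" "x \<in> M"
  shows "(\<lambda>n. T (X n)) \<longlonglongrightarrow> T x"
proof -
  obtain K where K: "\<And>x. x \<in> M \<Longrightarrow> norm (T x) \<le> K * norm x" using bounded_op_bound by blast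
  show ?thesis
  proof (rule LIM_zero_cancel, rule tendsto_0_le[where K = K])
    show "(\<lambda>n. X n - x) \<longlonglongrightarrow> 0" using assms(2) by (rule LIM_zero)
    show "\<forall>\<^sub>F n in sequentially. norm (T (X n) - T x) \<le> norm (X n - x) * K"
      using K[OF csubspace_diff[OF bounded_op_csubspace assms(1,3)]] bounded_op_diff[OF assms(1,3)]
      by (simp add: mult.commute)
  qed
qed

lemma bounded_op_restrict:
  assumes "closed_csubspace N" "N \<subseteq> M" "T ` N \<subseteq> N"
  shows "bounded_op_on N T"
  using T assms unfolding bounded_op_on_def by blast

end

lemma bounded_op_ident: "closed_csubspace M \<Longrightarrow> bounded_op_on M (\<lambda>x. x)"
  by (rule bounded_op_onI[where K = 1]) auto

lemma bounded_op_0: "closed_csubspace M \<Longrightarrow> bounded_op_on M (\<lambda>x. 0)"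
  by (rule bounded_op_onI[where K = 0]) (auto simp: csubspace_zero)

lemma bounded_op_plus:
  assumes S: "bounded_op_on M S" and T: "bounded_op_on M T"
  shows "bounded_op_on M (\<lambda>x. S x + T x)"
proof -
  note M = bounded_op_csubspace[OF S]
  obtain K L where K: "\<And>x. x \<in> M \<Longrightarrow> norm (S x) \<le> K * norm x"
    and L: "\<And>x. x \<in> M \<Longrightarrow> norm (T x) \<le> L * norm x"
    using bounded_op_bound[OF S] bounded_op_bound[OF T] by metis
  show ?thesis
  proof (rule bounded_op_onI[where K = "K + L", OF M])
    show "norm (S x + T x) \<le> (K + L) * norm x" if "x \<in> M" for x
      using norm_triangle_ineq[of "S x" "T x"] K[OF that] L[OF that] by (simp add: distrib_right)
  qed (auto simp: bounded_op_in[OF S] bounded_op_in[OF T] bounded_op_add[OF S] bounded_op_add[OF T]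
      bounded_op_scaleC[OF S] bounded_op_scaleC[OF T] scaleC_add_right intro!: csubspace_add[OF M])
qed

lemma bounded_op_scale:
  assumes T: "bounded_op_on M T" shows "bounded_op_on M (\<lambda>x. c *\<^sub>C T x)"
proof -
  obtain K where K: "\<And>x. x \<in> M \<Longrightarrow> norm (T x) \<le> K * norm x" using bounded_op_bound[OF T] by metis
  show ?thesis
  proof (rule bounded_op_onI[where K = "cmod c * K", OF bounded_op_csubspace[OF T]])
    show "norm (c *\<^sub>C T x) \<le> cmod c * K * norm x" if "x \<in> M" for x
      using mult_left_mono[OF K[OF that], of "cmod c"] by (simp add: norm_scaleC mult.assoc)
  qed (auto simp: bounded_op_in[OF T] bounded_op_add[OF T] bounded_op_scaleC[OF T] scaleC_add_right
      mult.commute intro!: csubspace_scaleC[OF bounded_op_csubspace[OF T]])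
qed

lemma bounded_op_minus_op:
  assumes "bounded_op_on M S" "bounded_op_on M T"
  shows "bounded_op_on M (\<lambda>x. S x - T x)"
  using bounded_op_plus[OF assms(1) bounded_op_scale[OF assms(2), of "-1"]] by simp

lemma bounded_op_comp:
  assumes S: "bounded_op_on M S" and T: "bounded_op_on M T"
  shows "bounded_op_on M (\<lambda>x. S (T x))"
proof -
  obtain K L where K: "0 \<le> K" "\<And>x. x \<in> M \<Longrightarrow> norm (S x) \<le> K * norm x"
    and L: "\<And>x. x \<in> M \<Longrightarrow> norm (T x) \<le> L * norm x"
    using bounded_op_bound[OF S] bounded_op_bound[OF T] by metis
  show ?thesis
  proof (rule bounded_op_onI[where K = "K * L", OF bounded_op_csubspace[OF T]])
    show "norm (S (T x)) \<le> K * L * norm x" if "x \<in> M" for x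
      using K(2)[OF bounded_op_in[OF T that]] mult_left_mono[OF L[OF that] K(1)]
      by (simp add: mult.assoc)
  qed (auto simp: bounded_op_in[OF S] bounded_op_in[OF T] bounded_op_add[OF S] bounded_op_add[OF T]
      bounded_op_scaleC[OF S] bounded_op_scaleC[OF T])
qed

lemma bounded_op_pow: "bounded_op_on M T \<Longrightarrow> bounded_op_on M (T ^^ n)"
proof (induction n)
  case 0
  then show ?case using bounded_op_ident[OF bounded_op_csubspace] by (simp add: id_def)
next
  case (Suc n)
  then show ?case using bounded_op_comp[of M T "T ^^ n"] by (simp add: comp_def)
qed

lemma bounded_op_sum_op:
  assumes "closed_csubspace M" "\<And>i. i \<in> I \<Longrightarrow> bounded_op_on M (F i)"
  shows "bounded_op_on M (\<lambda>x. \<Sum>i\<in>I. F i x)"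
  using assms(2)
  by (induction I rule: infinite_finite_induct) (auto intro: bounded_op_0 bounded_op_plus assms(1))

lemma adj_on_spec:
  assumes T: "bounded_op_on M T" and y: "y \<in> M"
  shows adj_on_in: "adj_on M T y \<in> M"
    and cinner_adj_on: "x \<in> M \<Longrightarrow> cinner (T x) y = cinner x (adj_on M T y)"
proof -
  note M = bounded_op_csubspace[OF T]
  obtain K where K: "\<And>x. x \<in> M \<Longrightarrow> norm (T x) \<le> K * norm x" using bounded_op_bound[OF T] by metis
  have "cmod (cinner (T x) y) \<le> (K * norm y) * norm x" if "x \<in> M" for x
    using cmod_cinner_le[of "T x" y] mult_right_mono[OF K[OF that] norm_ge_zero[of y]]
    by (simp add: mult_ac)
  hence "\<exists>z\<in>M. \<forall>x\<in>M. cinner (T x) y = cinner x z"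
    by (intro riesz_on[OF M])
      (auto simp: bounded_op_add[OF T] bounded_op_scaleC[OF T] cinner_add_left cinner_scaleC_left)
  hence "\<exists>!z. z \<in> M \<and> (\<forall>x\<in>M. cinner (T x) y = cinner x z)"
    using cinner_eqI[OF M] by (metis (no_types, lifting))
  from theI'[OF this] show "adj_on M T y \<in> M"
    and "x \<in> M \<Longrightarrow> cinner (T x) y = cinner x (adj_on M T y)"
    unfolding adj_on_def by auto
qed

lemma cinner_adj_on':
  assumes T: "bounded_op_on M T" and "x \<in> M" "y \<in> M"
  shows "cinner y (T x) = cinner (adj_on M T y) x"
  using cinner_adj_on[OF T assms(3,2)] by (metis cinner_commute)

lemma adj_on_eqI:
  assumes T: "bounded_op_on M T" and "y \<in> M" "z \<in> M"
    and "\<And>x. x \<in> M \<Longrightarrow> cinner (T x) y = cinner x z"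
  shows "adj_on M T y = z"
  using assms adj_on_spec[OF T assms(2)] by (intro cinner_eqI[OF bounded_op_csubspace[OF T]]) auto

lemma norm_adj_on_le:
  assumes T: "bounded_op_on M T" and K: "0 \<le> K" "\<And>x. x \<in> M \<Longrightarrow> norm (T x) \<le> K * norm x"
    and y: "y \<in> M"
  shows "norm (adj_on M T y) \<le> K * norm y"
proof -
  let ?z = "adj_on M T y"
  have z: "?z \<in> M" by (rule adj_on_in[OF T y])
  have "(norm ?z)\<^sup>2 = cmod (cinner ?z ?z)" by (simp add: cinner_self norm_power)
  also have "\<dots> = cmod (cinner (T ?z) y)" by (simp add: cinner_adj_on[OF T y z])
  also have "\<dots> \<le> norm (T ?z) * norm y" by (rule cmod_cinner_le)
  also have "\<dots> \<le> K * norm ?z * norm y" by (intro mult_right_mono K z) simp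
  finally have "norm ?z * norm ?z \<le> norm ?z * (K * norm y)"
    by (simp add: power2_eq_square mult_ac)
  thus ?thesis using K(1) by (cases "?z = 0") (simp_all)
qed

lemma bounded_op_adj_on:
  assumes T: "bounded_op_on M T" shows "bounded_op_on M (adj_on M T)"
proof -
  note M = bounded_op_csubspace[OF T]
  obtain K where K: "0 \<le> K" "\<And>x. x \<in> M \<Longrightarrow> norm (T x) \<le> K * norm x"
    using bounded_op_bound[OF T] by metis
  show ?thesis
  proof (rule bounded_op_onI[where K = K, OF M])
    show "adj_on M T (x + y) = adj_on M T x + adj_on M T y" if "x \<in> M" "y \<in> M" for x y
      using that
      by (intro adj_on_eqI[OF T] csubspace_add[OF M])
        (auto simp: adj_on_in[OF T] cinner_add_right cinner_adj_on[OF T])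
    show "adj_on M T (c *\<^sub>C x) = c *\<^sub>C adj_on M T x" if "x \<in> M" for c x
      using that
      by (intro adj_on_eqI[OF T] csubspace_scaleC[OF M])
        (auto simp: adj_on_in[OF T] cinner_scaleC_right cinner_adj_on[OF T])
  qed (use adj_on_in[OF T] norm_adj_on_le[OF T K] in auto)
qed

lemma adj_on_adj_on:
  assumes T: "bounded_op_on M T" and "x \<in> M"
  shows "adj_on M (adj_on M T) x = T x"
  using assms cinner_adj_on'[OF T]
  by (intro adj_on_eqI[OF bounded_op_adj_on[OF T]]) (auto simp: bounded_op_in)

lemma adj_on_comp_commute:
  assumes S: "bounded_op_on M S" and T: "bounded_op_on M T"
    and comm: "\<And>x. x \<in> M \<Longrightarrow> S (T x) = T (S x)" and y: "y \<in> M"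
  shows "adj_on M S (adj_on M T y) = adj_on M T (adj_on M S y)"
proof (rule cinner_eqI[OF bounded_op_csubspace[OF S]])
  fix x assume x: "x \<in> M"
  have "cinner x (adj_on M S (adj_on M T y)) = cinner (T (S x)) y"
    by (simp add: cinner_adj_on[OF S] cinner_adj_on[OF T] x y adj_on_in[OF T] bounded_op_in[OF S])
  also have "\<dots> = cinner x (adj_on M T (adj_on M S y))"
    by (simp flip: comm[OF x]
        add: cinner_adj_on[OF S] cinner_adj_on[OF T] x y adj_on_in[OF S] bounded_op_in[OF T])
  finally show "cinner x (adj_on M S (adj_on M T y)) = cinner x (adj_on M T (adj_on M S y))" .
qed (auto intro!: adj_on_in[OF S] adj_on_in[OF T] y)


section \<open>Invertibility along a path and Koszul exactness\<close>

lemma bij_betw_scaleC: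
  assumes "closed_csubspace M" "c \<noteq> 0"
  shows "bij_betw (\<lambda>x. c *\<^sub>C x) M M"
  using assms by (intro bij_betw_byWitness[where f' = "\<lambda>x. inverse c *\<^sub>C x"])
    (auto intro: csubspace_scaleC)

text \<open>Solving \<open>T x = y\<close> means finding a fixed point of
  \<open>x \<mapsto> S\<^sup>-\<^sup>1 (y - (T x - S x))\<close>, a contraction as soon as \<open>T - S\<close> is smaller than the lower
  bound of \<open>S\<close>.\<close>

lemma bij_betw_perturb:
  fixes S T :: "'a::complex_hilbert \<Rightarrow> 'a"
  assumes S: "bounded_op_on M S" and T: "bounded_op_on M T" and bij: "bij_betw S M M"
    and lower: "\<And>x. x \<in> M \<Longrightarrow> c * norm x \<le> norm (S x)"
    and close: "\<And>x. x \<in> M \<Longrightarrow> norm (T x - S x) \<le> d * norm x" and d: "0 \<le> d" "d < c"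
  shows "bij_betw T M M"
proof -
  note M = bounded_op_csubspace[OF S]
  have c: "0 < c" using d by simp
  note D = bounded_op_minus_op[OF T S]
  have "\<exists>!x\<in>M. T x = y" if y: "y \<in> M" for y
  proof -
    define g where "g x = inv_into M S (y - (T x - S x))" for x
    have target: "y - (T x - S x) \<in> M" if "x \<in> M" for x
      by (intro csubspace_diff[OF M] y bounded_op_in[OF D] bounded_op_in[OF S] bounded_op_in[OF T] that)
    have gM: "g x \<in> M" and Sg: "S (g x) = y - (T x - S x)" if "x \<in> M" for x
      using target[OF that] bij
      by (auto simp: g_def bij_betw_def intro!: inv_into_into f_inv_into_f)
    have "\<exists>!x\<in>M. g x = x"
    proof (rule Banach_fix[where c = "d / c"])
      show "complete M" using csubspace_closed[OF M] by (simp add: complete_eq_closed)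
      show "M \<noteq> {}" using y by auto
      show "0 \<le> d / c" "d / c < 1" using c d by auto
      show "g ` M \<subseteq> M" using gM by auto
      fix u v assume u: "u \<in> M" and v: "v \<in> M"
      have "c * norm (g u - g v) \<le> norm (S (g u - g v))"
        by (intro lower csubspace_diff[OF M] gM u v)
      also have "S (g u - g v) = (T v - S v) - (T u - S u)"
        by (simp add: bounded_op_diff[OF S] gM u v Sg)
      also have "\<dots> = T (v - u) - S (v - u)"
        using bounded_op_diff[OF D v u] by simp
      also have "norm \<dots> \<le> d * norm (v - u)" by (intro close csubspace_diff[OF M] u v)
      finally show "dist (g u) (g v) \<le> d / c * dist u v"
        using c by (simp add: dist_norm field_simps norm_minus_commute)
    qed
    moreover have "g x = x \<longleftrightarrow> T x = y" if x: "x \<in> M" for x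
    proof -
      have "g x = x \<longleftrightarrow> S (g x) = S x"
        using bij gM[OF x] x by (auto simp: bij_betw_def inj_on_def)
      also have "\<dots> \<longleftrightarrow> T x = y" by (auto simp: Sg[OF x])
      finally show ?thesis .
    qed
    ultimately show ?thesis by metis
  qed
  moreover have "T x \<in> M" if "x \<in> M" for x using that by (rule bounded_op_in[OF T])
  ultimately show ?thesis
    unfolding bij_betw_def inj_on_def image_def by blast
qed

text \<open>The uniform lower bound \<open>c\<close> lets the continuation proceed in steps of a fixed length. It is
  assumed only for bijective \<open>F r\<close>, because in the application it comes from a bound on the
  inverse.\<close>

lemma bij_betw_continuation:
  fixes F :: "real \<Rightarrow> 'a::complex_hilbert \<Rightarrow> 'a"
  assumes F: "\<And>r. r \<in> {0..1} \<Longrightarrow> bounded_op_on M (F r)"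
    and lip: "\<And>r s x. r \<in> {0..1} \<Longrightarrow> s \<in> {0..1} \<Longrightarrow> x \<in> M \<Longrightarrow>
      norm (F s x - F r x) \<le> L * \<bar>s - r\<bar> * norm x"
    and lower: "\<And>r x. r \<in> {0..1} \<Longrightarrow> bij_betw (F r) M M \<Longrightarrow> x \<in> M \<Longrightarrow> c * norm x \<le> norm (F r x)"
    and c: "0 < c" and bij: "bij_betw (F 0) M M"
  shows "bij_betw (F 1) M M"
proof -
  obtain n :: nat where n: "\<bar>L\<bar> / c < n" using reals_Archimedean2 by blast
  have "0 \<le> \<bar>L\<bar> / c" using c by simp
  hence n0: "0 < n" using n by (cases n) auto
  have step: "\<bar>L\<bar> / n < c" using n n0 c by (simp add: field_simps)
  have "k \<le> n \<Longrightarrow> bij_betw (F (k / n)) M M" for k :: nat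
  proof (induction k)
    case 0
    then show ?case using bij by simp
  next
    case (Suc k)
    let ?r = "k / n" and ?s = "Suc k / n"
    have r: "?r \<in> {0..1}" and s: "?s \<in> {0..1}" using Suc.prems n0 by auto
    have bij_r: "bij_betw (F ?r) M M" using Suc by simp
    show ?case
    proof (rule bij_betw_perturb[OF F[OF r] F[OF s] bij_r lower[OF r bij_r] _ _ step])
      fix x assume x: "x \<in> M"
      have "\<bar>?s - ?r\<bar> = 1 / n" by (simp add: diff_divide_distrib[symmetric])
      hence "norm (F ?s x - F ?r x) \<le> L * (1 / n) * norm x" using lip[OF r s x] by simp
      also have "\<dots> \<le> \<bar>L\<bar> / n * norm x" by (intro mult_right_mono) (auto simp: divide_right_mono)
      finally show "norm (F ?s x - F ?r x) \<le> \<bar>L\<bar> / n * norm x" .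
    qed auto
  qed
  from this[of n] show ?thesis using n0 by simp
qed

text \<open>If \<open>D = \<alpha>A + \<beta>B + \<gamma>C\<close> is invertible, then \<open>D\<^sup>-\<^sup>1\<close> times \<open>(\<alpha>, \<beta>, \<gamma>)\<close> is a
  contracting homotopy of the Koszul complex; this is the source of all the preimages below.\<close>

lemma koszul_exact_onI:
  fixes A B C :: "'a::complex_hilbert \<Rightarrow> 'a"
  assumes A: "bounded_op_on M A" and B: "bounded_op_on M B" and C: "bounded_op_on M C"
    and AB: "\<And>x. x \<in> M \<Longrightarrow> A (B x) = B (A x)" and AC: "\<And>x. x \<in> M \<Longrightarrow> A (C x) = C (A x)"
    and BC: "\<And>x. x \<in> M \<Longrightarrow> B (C x) = C (B x)"
    and bij: "bij_betw (\<lambda>x. \<alpha> *\<^sub>C A x + \<beta> *\<^sub>C B x + \<gamma> *\<^sub>C C x) M M"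
  shows "koszul_exact_on M A B C"
proof -
  note M = bounded_op_csubspace[OF A]
  define D where "D x = \<alpha> *\<^sub>C A x + \<beta> *\<^sub>C B x + \<gamma> *\<^sub>C C x" for x
  have D: "bounded_op_on M D"
    unfolding D_def by (intro bounded_op_plus bounded_op_scale A B C)
  have Dbij: "bij_betw D M M" using bij unfolding D_def .
  have Dinj: "x = y" if "x \<in> M" "y \<in> M" "D x = D y" for x y
    using Dbij that by (auto simp: bij_betw_def inj_on_def)
  have Dsurj: "\<exists>x\<in>M. D x = y" if "y \<in> M" for y
    using Dbij that by (auto simp: bij_betw_def image_iff Bex_def) (metis imageE)
  note in_M = bounded_op_in[OF A] bounded_op_in[OF B] bounded_op_in[OF C] bounded_op_in[OF D]
    csubspace_add[OF M] csubspace_diff[OF M] csubspace_scaleC[OF M] csubspace_minus[OF M]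
  note lin = bounded_op_add[OF A] bounded_op_add[OF B] bounded_op_add[OF C]
    bounded_op_diff[OF A] bounded_op_diff[OF B] bounded_op_diff[OF C]
    bounded_op_scaleC[OF A] bounded_op_scaleC[OF B] bounded_op_scaleC[OF C]
    bounded_op_minus[OF A] bounded_op_minus[OF B] bounded_op_minus[OF C]
  have DA: "D (A x) = A (D x)" and DB: "D (B x) = B (D x)" and DC: "D (C x) = C (D x)"
    if "x \<in> M" for x
    using that by (simp_all add: D_def lin in_M AB AC BC)
  have deg0: "{x \<in> M. koszul0 A B C x = 0} = {0}"
  proof -
    have "x = 0" if "x \<in> M" "koszul0 A B C x = 0" for x
      by (rule Dinj) (use that in \<open>auto simp: koszul0_def D_def zero_prod_def csubspace_zero[OF M]
          bounded_op_zero[OF A] bounded_op_zero[OF B] bounded_op_zero[OF C]\<close>)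
    thus ?thesis
      by (auto simp: koszul0_def zero_prod_def csubspace_zero[OF M]
          bounded_op_zero[OF A] bounded_op_zero[OF B] bounded_op_zero[OF C])
  qed
  have deg1: "{v \<in> M \<times> M \<times> M. koszul1 A B C v = 0} = koszul0 A B C ` M"
  proof (intro equalityI subsetI)
    fix v assume "v \<in> {v \<in> M \<times> M \<times> M. koszul1 A B C v = 0}"
    then obtain x1 x2 x3 where v: "v = (x1, x2, x3)" "x1 \<in> M" "x2 \<in> M" "x3 \<in> M"
      and eq: "A x2 = B x1" "A x3 = C x1" "B x3 = C x2"
      by (auto simp: koszul1_def zero_prod_def)
    obtain x where x: "x \<in> M" "D x = \<alpha> *\<^sub>C x1 + \<beta> *\<^sub>C x2 + \<gamma> *\<^sub>C x3"
      using Dsurj[of "\<alpha> *\<^sub>C x1 + \<beta> *\<^sub>C x2 + \<gamma> *\<^sub>C x3"] v in_M by auto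
    have "A x = x1" "B x = x2" "C x = x3"
      by (rule Dinj; simp add: v x in_M DA DB DC lin eq D_def[of x1] D_def[of x2] D_def[of x3])+
    thus "v \<in> koszul0 A B C ` M" using x v by (auto simp: koszul0_def)
  next
    fix v assume "v \<in> koszul0 A B C ` M"
    thus "v \<in> {v \<in> M \<times> M \<times> M. koszul1 A B C v = 0}"
      by (auto simp: koszul0_def koszul1_def zero_prod_def in_M AB AC BC)
  qed
  have deg2: "{v \<in> M \<times> M \<times> M. koszul2 A B C v = 0} = koszul1 A B C ` (M \<times> M \<times> M)"
  proof (intro equalityI subsetI)
    fix v assume "v \<in> {v \<in> M \<times> M \<times> M. koszul2 A B C v = 0}"
    then obtain y12 y13 y23 where v: "v = (y12, y13, y23)" "y12 \<in> M" "y13 \<in> M" "y23 \<in> M"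
      and eq: "A y23 - B y13 + C y12 = 0"
      by (auto simp: koszul2_def)
    obtain u12 u13 u23 where u: "u12 \<in> M" "u13 \<in> M" "u23 \<in> M"
      and Du: "D u12 = y12" "D u13 = y13" "D u23 = y23" using Dsurj v by metis
    have "A u23 - B u13 + C u12 = 0"
    proof (rule Dinj)
      have "D (A u23 - B u13 + C u12) = A y23 - B y13 + C y12"
        using u Du by (simp add: bounded_op_add[OF D] bounded_op_diff[OF D] in_M DA DB DC)
      thus "D (A u23 - B u13 + C u12) = D 0" using eq by (simp add: bounded_op_zero[OF D])
    qed (use u in_M csubspace_zero[OF M] in auto)
    hence C12: "C u12 = B u13 - A u23" and B13: "B u13 = A u23 + C u12"
      and A23: "A u23 = B u13 - C u12" by (simp_all add: algebra_simps)
    let ?x1 = "- (\<beta> *\<^sub>C u12 + \<gamma> *\<^sub>C u13)" and ?x2 = "\<alpha> *\<^sub>C u12 - \<gamma> *\<^sub>C u23"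
      and ?x3 = "\<alpha> *\<^sub>C u13 + \<beta> *\<^sub>C u23"
    have "A ?x2 - B ?x1 = D u12"
      by (simp add: D_def lin in_M u C12 scaleC.scale_right_diff_distrib)
    moreover have "A ?x3 - C ?x1 = D u13"
      by (simp add: D_def lin in_M u B13 scaleC_add_right)
    moreover have "B ?x3 - C ?x2 = D u23"
      by (simp add: D_def lin in_M u A23 scaleC.scale_right_diff_distrib)
    ultimately have "koszul1 A B C (?x1, ?x2, ?x3) = v"
      by (simp add: koszul1_def v Du)
    thus "v \<in> koszul1 A B C ` (M \<times> M \<times> M)"
      using u in_M by (intro image_eqI[where x = "(?x1, ?x2, ?x3)"]) auto
  next
    fix v assume "v \<in> koszul1 A B C ` (M \<times> M \<times> M)"
    thus "v \<in> {v \<in> M \<times> M \<times> M. koszul2 A B C v = 0}"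
      by (auto simp: koszul1_def koszul2_def in_M lin AB AC BC)
  qed
  have deg3: "koszul2 A B C ` (M \<times> M \<times> M) = M"
  proof (intro equalityI subsetI)
    fix y assume "y \<in> M"
    then obtain u where u: "u \<in> M" "D u = y" using Dsurj by blast
    have "koszul2 A B C (\<gamma> *\<^sub>C u, - (\<beta> *\<^sub>C u), \<alpha> *\<^sub>C u) = y"
      using u by (simp add: koszul2_def D_def lin in_M)
    thus "y \<in> koszul2 A B C ` (M \<times> M \<times> M)" using u in_M by (auto intro!: image_eqI[OF sym])
  qed (auto simp: koszul2_def in_M)
  show ?thesis unfolding koszul_exact_on_def using deg0 deg1 deg2 deg3 by simp
qed


section \<open>Polynomials in a commuting triple\<close>

lemma poly3_eval_sum:
  assumes "finite S" "Poly_Mapping.keys p \<subseteq> S"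
  shows "poly3_eval p (a, b, c) = (\<Sum>(i, j, k)\<in>S. Poly_Mapping.lookup p (i, j, k) * a ^ i * b ^ j * c ^ k)"
  unfolding poly3_eval_def prod.case
  by (rule sum.mono_neutral_left) (use assms in \<open>auto simp: in_keys_iff\<close>)

lemma poly3_op_sum:
  assumes "finite S" "Poly_Mapping.keys p \<subseteq> S"
  shows "poly3_op p A B C x =
    (\<Sum>(i, j, k)\<in>S. Poly_Mapping.lookup p (i, j, k) *\<^sub>C (A ^^ i) ((B ^^ j) ((C ^^ k) x)))"
  unfolding poly3_op_def
  by (rule sum.mono_neutral_left) (use assms in \<open>auto simp: in_keys_iff\<close>)

definition affine3 :: "complex \<Rightarrow> complex \<Rightarrow> complex \<Rightarrow> complex \<Rightarrow> poly3" where
  "affine3 c0 c1 c2 c3 = Poly_Mapping.single (0, 0, 0) c0 + Poly_Mapping.single (1, 0, 0) c1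
     + Poly_Mapping.single (0, 1, 0) c2 + Poly_Mapping.single (0, 0, 1) c3"

lemma keys_affine3:
  "Poly_Mapping.keys (affine3 c0 c1 c2 c3) \<subseteq> {(0, 0, 0), (1, 0, 0), (0, 1, 0), (0, 0, 1)}"
  unfolding affine3_def by (intro order_trans[OF keys_add] Un_least) auto

lemma poly3_eval_affine3 [simp]:
  "poly3_eval (affine3 c0 c1 c2 c3) (a, b, c) = c0 + c1 * a + c2 * b + c3 * c"
  by (subst poly3_eval_sum[OF _ keys_affine3]) (auto simp: affine3_def lookup_add lookup_single)

lemma poly3_op_affine3 [simp]:
  "poly3_op (affine3 c0 c1 c2 c3) A B C x = c0 *\<^sub>C x + c1 *\<^sub>C A x + c2 *\<^sub>C B x + c3 *\<^sub>C C x"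
  by (subst poly3_op_sum[OF _ keys_affine3]) (auto simp: affine3_def lookup_add lookup_single)

definition conj_poly3 :: "poly3 \<Rightarrow> poly3" where
  "conj_poly3 p = Poly_Mapping.mapp (\<lambda>_. cnj) p"

lemma poly3_eval_conj: "poly3_eval (conj_poly3 p) (cnj a, cnj b, cnj c) = cnj (poly3_eval p (a, b, c))"
  unfolding conj_poly3_def
  by (subst poly3_eval_sum[OF _ keys_mapp_subset])
    (auto simp: poly3_eval_def lookup_mapp intro!: sum.cong)

text \<open>\<open>dilate3 r p\<close> is \<open>p (r a, r b, r\<^sup>2 c)\<close>. Replacing \<open>(z, w)\<close> by \<open>(r z, r w)\<close> in
  \<open>1 - z x\<^sub>1 - w x\<^sub>2 + z w x\<^sub>3\<close> shows that these weights map the closed tetrablock into itself.\<close>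

definition dilate3 :: "real \<Rightarrow> poly3 \<Rightarrow> poly3" where
  "dilate3 r p = Poly_Mapping.mapp (\<lambda>(i, j, k) a. of_real (r ^ (i + j + 2 * k)) * a) p"

lemma poly3_eval_dilate:
  "poly3_eval (dilate3 r p) (a, b, c) = poly3_eval p (of_real r * a, of_real r * b, (of_real r)\<^sup>2 * c)"
proof -
  have monomial: "of_real (r ^ (i + j + 2 * k)) * l * a ^ i * b ^ j * c ^ k
      = l * (of_real r * a) ^ i * (of_real r * b) ^ j * ((of_real r)\<^sup>2 * c) ^ k" for i j k l
    by (simp only: power_add power_mult of_real_mult of_real_power power_mult_distrib)
      (simp only: mult_ac)
  show ?thesis
    unfolding dilate3_def
    by (subst poly3_eval_sum[OF _ keys_mapp_subset])
      (auto simp: poly3_eval_def lookup_mapp monomial simp del: of_real_power intro!: sum.cong)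
qed

lemma poly3_op_dilate:
  "poly3_op (dilate3 r p) A B C x = (\<Sum>(i, j, k)\<in>Poly_Mapping.keys p.
     of_real (r ^ (i + j + 2 * k)) *\<^sub>C Poly_Mapping.lookup p (i, j, k) *\<^sub>C
       (A ^^ i) ((B ^^ j) ((C ^^ k) x)))"
  unfolding dilate3_def
  by (subst poly3_op_sum[OF _ keys_mapp_subset]) (auto simp: lookup_mapp scaleC_scaleC intro!: sum.cong)

lemma poly3_op_dilate_1: "poly3_op (dilate3 1 p) A B C x = poly3_op p A B C x"
  by (simp only: poly3_op_dilate) (simp add: poly3_op_def split_def)

lemma poly3_op_dilate_0: "poly3_op (dilate3 0 p) A B C x = poly3_eval p (0, 0, 0) *\<^sub>C x"
proof -
  have "0 ^ (i + j + 2 * k) *\<^sub>C Poly_Mapping.lookup p (i, j, k) *\<^sub>C (A ^^ i) ((B ^^ j) ((C ^^ k) x))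
      = (Poly_Mapping.lookup p (i, j, k) * 0 ^ i * 0 ^ j * 0 ^ k) *\<^sub>C x" for i j k
    by (cases "i = 0"; cases "j = 0"; cases "k = 0") (auto simp: power_0_left)
  thus ?thesis
    by (auto simp: poly3_op_dilate poly3_eval_def scaleC.scale_sum_left intro!: sum.cong)
qed

lemma pow_in: "T ` M \<subseteq> M \<Longrightarrow> x \<in> M \<Longrightarrow> (T ^^ n) x \<in> M"
  by (induction n) auto

lemma pow_commute:
  assumes "T ` M \<subseteq> M" "\<And>x. x \<in> M \<Longrightarrow> S (T x) = T (S x)" "x \<in> M"
  shows "S ((T ^^ n) x) = (T ^^ n) (S x)"
proof (induction n)
  case (Suc n)
  then show ?case using assms(2)[OF pow_in[OF assms(1,3)]] by simp
qed simp

context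
  fixes M :: "'a::complex_hilbert set" and A B P :: "'a \<Rightarrow> 'a"
  assumes triple: "commuting_triple_on M A B P"
begin

lemma triple_bounded: "bounded_op_on M A" "bounded_op_on M B" "bounded_op_on M P"
  using triple by (auto simp: commuting_triple_on_def)

lemma triple_commute:
  "x \<in> M \<Longrightarrow> A (B x) = B (A x)" "x \<in> M \<Longrightarrow> A (P x) = P (A x)" "x \<in> M \<Longrightarrow> B (P x) = P (B x)"
  using triple by (auto simp: commuting_triple_on_def)

lemma bounded_op_monomial: "bounded_op_on M (\<lambda>x. (A ^^ i) ((B ^^ j) ((P ^^ k) x)))"
  by (rule bounded_op_comp[OF _ bounded_op_comp]; rule bounded_op_pow; rule triple_bounded)

lemma bounded_op_poly3: "bounded_op_on M (poly3_op p A B P)"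
proof -
  have "bounded_op_on M (\<lambda>x. \<Sum>t\<in>Poly_Mapping.keys p. (case t of (i, j, k) \<Rightarrow>
      \<lambda>x. Poly_Mapping.lookup p (i, j, k) *\<^sub>C (A ^^ i) ((B ^^ j) ((P ^^ k) x))) x)"
    by (intro bounded_op_sum_op bounded_op_csubspace[OF triple_bounded(1)])
      (auto intro!: bounded_op_scale bounded_op_monomial)
  thus ?thesis by (simp add: poly3_op_def[abs_def] split_def)
qed

lemma poly3_op_commute:
  assumes S: "bounded_op_on M S" and x: "x \<in> M"
    and "\<And>x. x \<in> M \<Longrightarrow> S (A x) = A (S x)" "\<And>x. x \<in> M \<Longrightarrow> S (B x) = B (S x)"
      "\<And>x. x \<in> M \<Longrightarrow> S (P x) = P (S x)"
  shows "S (poly3_op p A B P x) = poly3_op p A B P (S x)"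
proof -
  have im: "A ` M \<subseteq> M" "B ` M \<subseteq> M" "P ` M \<subseteq> M"
    using bounded_op_in triple_bounded by blast+
  have mon: "S ((A ^^ i) ((B ^^ j) ((P ^^ k) x))) = (A ^^ i) ((B ^^ j) ((P ^^ k) (S x)))" for i j k
    by (simp add: pow_commute[where S = S, OF im(1) assms(3)] pow_commute[where S = S, OF im(2) assms(4)]
        pow_commute[where S = S, OF im(3) assms(5)] pow_in im x)
  show ?thesis
    using bounded_op_in[OF bounded_op_monomial x]
    by (auto simp: poly3_op_def bounded_op_sum[OF S] bounded_op_scaleC[OF S] mon split_def
        csubspace_scaleC[OF bounded_op_csubspace[OF S]])
qed

lemma poly3_op_commute_poly3:
  assumes x: "x \<in> M"
  shows "poly3_op p A B P (poly3_op q A B P x) = poly3_op q A B P (poly3_op p A B P x)"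
proof (rule poly3_op_commute[OF bounded_op_poly3 x])
  show "poly3_op p A B P (A x) = A (poly3_op p A B P x)"
    "poly3_op p A B P (B x) = B (poly3_op p A B P x)"
    "poly3_op p A B P (P x) = P (poly3_op p A B P x)" if "x \<in> M" for x
    using that by (auto intro!: poly3_op_commute[symmetric] triple_bounded simp: triple_commute)
qed

lemma triple_restrict:
  assumes "joint_invariant_subspace A B P N" "N \<subseteq> M"
  shows "commuting_triple_on N A B P"
  using assms triple unfolding commuting_triple_on_def joint_invariant_subspace_def invariant_subspace_def
  by (meson bounded_op_restrict subsetD)

lemma triple_adj_on: "commuting_triple_on M (adj_on M A) (adj_on M B) (adj_on M P)"
  unfolding commuting_triple_on_def
  using triple_bounded triple_commute by (auto intro!: bounded_op_adj_on adj_on_comp_commute)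

lemma cinner_poly3_adj_on:
  assumes x: "x \<in> M" and y: "y \<in> M"
  shows "cinner (poly3_op (conj_poly3 p) A B P x) y =
    cinner x (poly3_op p (adj_on M A) (adj_on M B) (adj_on M P) y)"
proof -
  let ?A = "adj_on M A" and ?B = "adj_on M B" and ?P = "adj_on M P"
  have pow: "cinner ((T ^^ n) x) y = cinner x ((adj_on M T ^^ n) y)"
    if T: "bounded_op_on M T" and "x \<in> M" "y \<in> M" for T n x y
    using that(3)
  proof (induction n arbitrary: y)
    case (Suc n)
    then show ?case
      using cinner_adj_on[OF T Suc.prems bounded_op_in[OF bounded_op_pow[OF T] that(2)]]
      by (simp add: adj_on_in[OF T] funpow_swap1)
  qed simp
  note adj = triple_adj_on
  have im: "?A ` M \<subseteq> M" "?B ` M \<subseteq> M" "?P ` M \<subseteq> M"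
    using adj by (auto simp: commuting_triple_on_def bounded_op_on_def)
  have inn: "(A ^^ i) x \<in> M" "(B ^^ i) x \<in> M" "(P ^^ i) x \<in> M" if "x \<in> M" for x i
    using that by (auto intro!: bounded_op_in[OF bounded_op_pow] triple_bounded)
  have comm: "(?P ^^ k) ((?B ^^ j) ((?A ^^ i) y)) = (?A ^^ i) ((?B ^^ j) ((?P ^^ k) y))" for i j k
  proof -
    have BA: "?B ((?A ^^ i) u) = (?A ^^ i) (?B u)" if "u \<in> M" for u
      by (rule pow_commute[OF im(1) _ that]) (use adj in \<open>auto simp: commuting_triple_on_def\<close>)
    have PA: "?P ((?A ^^ i) u) = (?A ^^ i) (?P u)" if "u \<in> M" for u
      by (rule pow_commute[OF im(1) _ that]) (use adj in \<open>auto simp: commuting_triple_on_def\<close>)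
    have PB: "?P ((?B ^^ j) u) = (?B ^^ j) (?P u)" if "u \<in> M" for u
      by (rule pow_commute[OF im(2) _ that]) (use adj in \<open>auto simp: commuting_triple_on_def\<close>)
    have BjA: "(?B ^^ j) ((?A ^^ i) y) = (?A ^^ i) ((?B ^^ j) y)"
      using pow_commute[OF im(2), of "?A ^^ i" y j] BA y by simp
    have PkB: "(?B ^^ j) ((?P ^^ k) y) = (?P ^^ k) ((?B ^^ j) y)"
      using pow_commute[OF im(3), of "?B ^^ j" y k] PB y by simp
    have "(?A ^^ i) ((?P ^^ k) ((?B ^^ j) y)) = (?P ^^ k) ((?A ^^ i) ((?B ^^ j) y))"
      using pow_commute[OF im(3), of "?A ^^ i" "(?B ^^ j) y" k] PA y im by (simp add: pow_in)
    thus ?thesis using BjA PkB by simp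
  qed
  have mon: "cinner ((A ^^ i) ((B ^^ j) ((P ^^ k) x))) y
      = cinner x ((?A ^^ i) ((?B ^^ j) ((?P ^^ k) y)))" for i j k
    using x y im inn by (simp add: pow triple_bounded pow_in comm)
  have "poly3_op (conj_poly3 p) A B P x = (\<Sum>(i, j, k)\<in>Poly_Mapping.keys p.
      cnj (Poly_Mapping.lookup p (i, j, k)) *\<^sub>C (A ^^ i) ((B ^^ j) ((P ^^ k) x)))"
    unfolding conj_poly3_def
    by (subst poly3_op_sum[OF _ keys_mapp_subset]) (auto simp: lookup_mapp intro!: sum.cong)
  thus ?thesis
    by (simp add: poly3_op_def cinner_sum_left cinner_sum_right split_def cinner_scaleC_left
        cinner_scaleC_right mon)
qed

end


section \<open>The closed tetrablock\<close>

lemma tetrablock_bounds: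
  assumes x: "(x1, x2, x3) \<in> tetrablock" and z: "cmod z \<le> 1"
  shows "cmod (x2 - z * x3) \<le> cmod (1 - z * x1)" and "cmod x1 \<le> 1"
proof -
  have ne: "1 - z * x1 - w * x2 + z * w * x3 \<noteq> 0" if "cmod z \<le> 1" "cmod w \<le> 1" for z w
    using x that by (simp add: tetrablock_def)
  show "cmod (x2 - z * x3) \<le> cmod (1 - z * x1)"
  proof (rule ccontr)
    assume gt: "\<not> cmod (x2 - z * x3) \<le> cmod (1 - z * x1)"
    hence pos: "0 < cmod (x2 - z * x3)" using norm_ge_zero[of "1 - z * x1"] by linarith
    define w where "w = (1 - z * x1) / (x2 - z * x3)"
    have "w * (x2 - z * x3) = 1 - z * x1" using pos by (simp add: w_def)
    moreover have "cmod w \<le> 1" using gt pos by (simp add: w_def norm_divide)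
    ultimately show False using ne[OF z, of w] by (simp add: algebra_simps)
  qed
  show "cmod x1 \<le> 1"
  proof (rule ccontr)
    assume "\<not> cmod x1 \<le> 1"
    hence "cmod (1 / x1) \<le> 1" "x1 \<noteq> 0" by (auto simp: norm_divide divide_le_eq)
    thus False using ne[of "1 / x1" 0] by simp
  qed
qed

lemma closure_tetrablock_bounds:
  assumes x: "(x1, x2, x3) \<in> closure tetrablock" and z: "cmod z \<le> 1"
  shows "cmod (x2 - z * x3) \<le> cmod (1 - z * x1)" and "cmod x1 \<le> 1"
proof -
  have "closed {x :: complex \<times> complex \<times> complex.
      cmod (fst (snd x) - z * snd (snd x)) \<le> cmod (1 - z * fst x)}"
    by (intro closed_Collect_le continuous_intros)
  moreover have "closed {x :: complex \<times> complex \<times> complex. cmod (fst x) \<le> 1}"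
    by (intro closed_Collect_le continuous_intros)
  ultimately have "closure tetrablock \<subseteq>
      {x. cmod (fst (snd x) - z * snd (snd x)) \<le> cmod (1 - z * fst x)} \<inter> {x. cmod (fst x) \<le> 1}"
    using tetrablock_bounds[OF _ z] by (intro closure_minimal closed_Int) auto
  thus "cmod (x2 - z * x3) \<le> cmod (1 - z * x1)" and "cmod x1 \<le> 1" using x by auto
qed

text \<open>A zero \<open>w (x\<^sub>2 - z x\<^sub>3) = 1 - z x\<^sub>1\<close> with \<open>\<bar>w\<bar> < 1\<close> contradicts the previous bound;
  conversely \<open>(r x\<^sub>1, r x\<^sub>2, r\<^sup>2 x\<^sub>3)\<close> lies in the tetrablock for \<open>r < 1\<close>.\<close>

lemma closure_tetrablock_iff:
  "(x1, x2, x3) \<in> closure tetrablock \<longleftrightarrow>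
    (\<forall>z w. cmod z < 1 \<longrightarrow> cmod w < 1 \<longrightarrow> 1 - z * x1 - w * x2 + z * w * x3 \<noteq> 0)"
proof (intro iffI allI impI notI)
  fix z w
  assume x: "(x1, x2, x3) \<in> closure tetrablock" and z: "cmod z < 1" and w: "cmod w < 1"
    and "1 - z * x1 - w * x2 + z * w * x3 = 0"
  hence "1 - z * x1 = w * (x2 - z * x3)" by (simp add: algebra_simps)
  hence "cmod (1 - z * x1) = cmod w * cmod (x2 - z * x3)" by (metis norm_mult)
  also have "\<dots> \<le> cmod w * cmod (1 - z * x1)"
    using closure_tetrablock_bounds(1)[OF x] z by (intro mult_left_mono) auto
  finally have "(1 - cmod w) * cmod (1 - z * x1) \<le> 0" by (simp add: algebra_simps)
  hence "cmod (1 - z * x1) \<le> 0" using w by (simp add: mult_le_0_iff)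
  hence "z * x1 = 1" by simp
  hence "cmod z * cmod x1 = 1" by (metis norm_mult norm_one)
  moreover have "cmod z * cmod x1 \<le> cmod z * 1"
    using closure_tetrablock_bounds(2)[OF x, of 0] by (intro mult_left_mono) auto
  ultimately show False using z by simp
next
  assume ne: "\<forall>z w. cmod z < 1 \<longrightarrow> cmod w < 1 \<longrightarrow> 1 - z * x1 - w * x2 + z * w * x3 \<noteq> 0"
  define r where "r n = 1 - 1 / real (Suc n)" for n
  have r: "0 \<le> r n" "r n < 1" for n by (auto simp: r_def)
  have lim: "r \<longlonglongrightarrow> 1"
    unfolding r_def
    using tendsto_diff[OF tendsto_const LIMSEQ_inverse_real_of_nat, of "1"]
    by (simp add: inverse_eq_divide)
  define X where "X n = (of_real (r n) * x1, of_real (r n) * x2, (of_real (r n))\<^sup>2 * x3)" for n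
  have "X n \<in> tetrablock" for n
  proof -
    have "1 - z * (of_real (r n) * x1) - w * (of_real (r n) * x2)
        + z * w * ((of_real (r n))\<^sup>2 * x3) \<noteq> 0" if "cmod z \<le> 1" "cmod w \<le> 1" for z w
    proof -
      have "cmod (of_real (r n) * u) < 1" if "cmod u \<le> 1" for u
        using r[of n] that mult_left_mono[OF that r(1)[of n]] by (simp add: norm_mult)
      hence "1 - (of_real (r n) * z) * x1 - (of_real (r n) * w) * x2
          + (of_real (r n) * z) * (of_real (r n) * w) * x3 \<noteq> 0"
        using ne that by blast
      thus ?thesis by (simp add: power2_eq_square mult_ac)
    qed
    thus ?thesis by (simp add: X_def tetrablock_def)
  qed
  moreover have "X \<longlonglongrightarrow> (of_real 1 * x1, of_real 1 * x2, (of_real 1)\<^sup>2 * x3)"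
    unfolding X_def by (intro tendsto_intros lim)
  ultimately show "(x1, x2, x3) \<in> closure tetrablock"
    by (auto simp: closure_sequential)
qed

lemma closure_tetrablock_swap:
  assumes "(x1, x2, x3) \<in> closure tetrablock" shows "(x2, x1, x3) \<in> closure tetrablock"
  unfolding closure_tetrablock_iff
proof (intro allI impI)
  fix z w :: complex assume "cmod z < 1" "cmod w < 1"
  hence "1 - w * x1 - z * x2 + w * z * x3 \<noteq> 0"
    using assms unfolding closure_tetrablock_iff by blast
  thus "1 - z * x2 - w * x1 + z * w * x3 \<noteq> 0" by (simp add: algebra_simps)
qed

lemma closure_tetrablock_cnj:
  assumes "(x1, x2, x3) \<in> closure tetrablock" shows "(cnj x1, cnj x2, cnj x3) \<in> closure tetrablock"
  unfolding closure_tetrablock_iff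
proof (intro allI impI)
  fix z w :: complex assume "cmod z < 1" "cmod w < 1"
  hence "1 - cnj z * x1 - cnj w * x2 + cnj z * cnj w * x3 \<noteq> 0"
    using assms unfolding closure_tetrablock_iff by simp
  hence "cnj (1 - cnj z * x1 - cnj w * x2 + cnj z * cnj w * x3) \<noteq> 0"
    by (simp only: complex_cnj_zero_iff not_False_eq_True)
  thus "1 - z * cnj x1 - w * cnj x2 + z * w * cnj x3 \<noteq> 0" by simp
qed

lemma closure_tetrablock_dilate:
  assumes x: "(x1, x2, x3) \<in> closure tetrablock" and r: "r \<in> {0..1}"
  shows "(of_real r * x1, of_real r * x2, (of_real r)\<^sup>2 * x3) \<in> closure tetrablock"
  unfolding closure_tetrablock_iff
proof (intro allI impI)
  fix z w :: complex assume "cmod z < 1" "cmod w < 1"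
  moreover have "cmod (of_real r * u) < 1" if "cmod u < 1" for u :: complex
    using r that mult_left_le_one_le[of "cmod u" r] by (auto simp: norm_mult)
  ultimately have "1 - (of_real r * z) * x1 - (of_real r * w) * x2
      + (of_real r * z) * (of_real r * w) * x3 \<noteq> 0"
    using x unfolding closure_tetrablock_iff by blast
  thus "1 - z * (of_real r * x1) - w * (of_real r * x2) + z * w * ((of_real r)\<^sup>2 * x3) \<noteq> 0"
    by (simp add: power2_eq_square mult_ac)
qed

lemma zero_in_closure_tetrablock: "(0, 0, 0) \<in> closure tetrablock"
  by (simp add: closure_tetrablock_iff)

lemma compact_closure_tetrablock: "compact (closure tetrablock)"
proof -
  have "tetrablock \<subseteq> cball 0 1 \<times> cball 0 1 \<times> cball 0 3"
  proof clarify
    fix x1 x2 x3 assume x: "(x1, x2, x3) \<in> tetrablock"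
    have 1: "cmod x1 \<le> 1" and 2: "cmod (x2 - x3) \<le> cmod (1 - x1)"
      using tetrablock_bounds[OF x, of 1] by auto
    have "(x2, x1, x3) \<in> closure tetrablock" using x closure_subset closure_tetrablock_swap by blast
    from closure_tetrablock_bounds(2)[OF this, of 0] have 3: "cmod x2 \<le> 1" by simp
    have "cmod x3 \<le> cmod x2 + cmod (x2 - x3)" by (metis norm_triangle_sub norm_minus_commute)
    moreover have "cmod (1 - x1) \<le> 1 + cmod x1" using norm_triangle_ineq4[of 1 x1] by simp
    ultimately have "cmod x3 \<le> 3" using 1 2 3 by linarith
    thus "x1 \<in> cball 0 1 \<and> (x2, x3) \<in> cball 0 1 \<times> cball 0 3" using 1 3 by simp
  qed
  hence "bounded tetrablock" by (rule bounded_subset[rotated]) (intro bounded_Times bounded_cball)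
  thus ?thesis by simp
qed


section \<open>The von Neumann inequality characterises E-contractions\<close>

definition tetra_nonvanishing :: "poly3 \<Rightarrow> bool" where
  "tetra_nonvanishing q \<longleftrightarrow> (\<forall>z\<in>closure tetrablock. poly3_eval q z \<noteq> 0)"

definition tetra_sup :: "poly3 \<Rightarrow> poly3 \<Rightarrow> real" where
  "tetra_sup p q = (SUP z\<in>closure tetrablock. cmod (poly3_eval p z / poly3_eval q z))"

lemma continuous_poly3_eval: "continuous_on S (poly3_eval p)"
  unfolding poly3_eval_def split_def by (intro continuous_intros)

lemma tetra_sup_upper:
  assumes q: "tetra_nonvanishing q" and z: "z \<in> closure tetrablock"
  shows "cmod (poly3_eval p z / poly3_eval q z) \<le> tetra_sup p q"
  unfolding tetra_sup_def
proof (rule cSUP_upper[OF z])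
  have "compact ((\<lambda>z. cmod (poly3_eval p z / poly3_eval q z)) ` closure tetrablock)"
    using q
    by (intro compact_continuous_image compact_closure_tetrablock continuous_intros continuous_poly3_eval)
      (auto simp: tetra_nonvanishing_def)
  thus "bdd_above ((\<lambda>z. cmod (poly3_eval p z / poly3_eval q z)) ` closure tetrablock)"
    by (intro bounded_imp_bdd_above compact_imp_bounded)
qed

lemma tetra_sup_nonneg: "tetra_nonvanishing q \<Longrightarrow> 0 \<le> tetra_sup p q"
  using tetra_sup_upper[OF _ zero_in_closure_tetrablock, of q p] norm_ge_zero order_trans by blast

lemma tetra_sup_least:
  assumes "\<And>z. z \<in> closure tetrablock \<Longrightarrow> cmod (poly3_eval p z / poly3_eval q z) \<le> c"
  shows "tetra_sup p q \<le> c"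
  unfolding tetra_sup_def using zero_in_closure_tetrablock assms by (intro cSUP_least) auto

lemma tetra_dilate:
  assumes q: "tetra_nonvanishing q" and r: "r \<in> {0..1}"
  shows "tetra_nonvanishing (dilate3 r q)"
    and "tetra_sup (affine3 1 0 0 0) (dilate3 r q) \<le> tetra_sup (affine3 1 0 0 0) q"
proof -
  show "tetra_nonvanishing (dilate3 r q)"
    using q closure_tetrablock_dilate[OF _ r] by (auto simp: tetra_nonvanishing_def poly3_eval_dilate)
  show "tetra_sup (affine3 1 0 0 0) (dilate3 r q) \<le> tetra_sup (affine3 1 0 0 0) q"
  proof (rule tetra_sup_least)
    fix z assume z: "z \<in> closure tetrablock"
    obtain a b c where "z = (a, b, c)" by (cases z)
    thus "cmod (poly3_eval (affine3 1 0 0 0) z / poly3_eval (dilate3 r q) z)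
        \<le> tetra_sup (affine3 1 0 0 0) q"
      using tetra_sup_upper[OF q closure_tetrablock_dilate[OF _ r], of a b c "affine3 1 0 0 0"] z
      by (simp add: poly3_eval_dilate)
  qed
qed

lemma tetra_conj:
  shows "tetra_nonvanishing (conj_poly3 q) \<longleftrightarrow> tetra_nonvanishing q"
    and "tetra_sup (conj_poly3 p) (conj_poly3 q) = tetra_sup p q"
proof -
  define c where "c = (\<lambda>(a, b, c). (cnj a, cnj b, cnj c))"
  have inv: "c (c z) = z" and ev: "poly3_eval (conj_poly3 p) (c z) = cnj (poly3_eval p z)" for p z
    by (auto simp: c_def poly3_eval_conj split: prod.split)
  have cK: "c z \<in> closure tetrablock" if "z \<in> closure tetrablock" for z
    using that closure_tetrablock_cnj by (cases z) (auto simp: c_def)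
  hence im: "c ` closure tetrablock = closure tetrablock" by (auto intro!: image_eqI[where x = "c _"] simp: inv)
  show "tetra_nonvanishing (conj_poly3 q) \<longleftrightarrow> tetra_nonvanishing q"
    unfolding tetra_nonvanishing_def by (subst im[symmetric]) (simp add: ev)
  show "tetra_sup (conj_poly3 p) (conj_poly3 q) = tetra_sup p q"
    unfolding tetra_sup_def by (subst im[symmetric]) (simp add: image_image ev norm_divide)
qed

text \<open>A denominator is deformed to a constant along \<open>dilate3 r q\<close>, \<open>0 \<le> r \<le> 1\<close>. The dilations
  map the closed tetrablock into itself, so all the functions \<open>1 / dilate3 r q\<close> are bounded by the
  supremum of \<open>1 / q\<close> and the von Neumann inequality gives one lower bound along the path.\<close>

lemma bij_betw_poly3_op:
  assumes triple: "commuting_triple_on M A B P" and q: "tetra_nonvanishing q"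
    and lower: "\<And>q x. tetra_nonvanishing q \<Longrightarrow> bij_betw (poly3_op q A B P) M M \<Longrightarrow> x \<in> M \<Longrightarrow>
      norm x \<le> tetra_sup (affine3 1 0 0 0) q * norm (poly3_op q A B P x)"
  shows "bij_betw (poly3_op q A B P) M M"
proof -
  note M = bounded_op_csubspace[OF triple_bounded(1)[OF triple]]
  define C where "C = tetra_sup (affine3 1 0 0 0) q + 1"
  have C: "0 < C" using tetra_sup_nonneg[OF q, of "affine3 1 0 0 0"] by (simp add: C_def)
  define Q where "Q t = (case t of (i, j, k) \<Rightarrow>
    \<lambda>x. Poly_Mapping.lookup q (i, j, k) *\<^sub>C (A ^^ i) ((B ^^ j) ((P ^^ k) x)))" for t :: "nat \<times> nat \<times> nat"
  define e where "e t = (case t of (i, j, k) \<Rightarrow> i + j + 2 * k)" for t :: "nat \<times> nat \<times> nat"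
  have F: "poly3_op (dilate3 r q) A B P x
      = (\<Sum>t\<in>Poly_Mapping.keys q. of_real (r ^ e t) *\<^sub>C Q t x)" for r x
    by (simp add: poly3_op_dilate Q_def e_def split_def)
  have "\<exists>K\<ge>0. \<forall>x\<in>M. norm (Q t x) \<le> K * norm x" for t
  proof -
    obtain i j k where t: "t = (i, j, k)" by (cases t)
    have "bounded_op_on M (Q t)"
      unfolding t Q_def by (simp add: bounded_op_scale bounded_op_monomial[OF triple])
    thus ?thesis by (metis bounded_op_bound)
  qed
  then obtain K where K: "\<And>t. 0 \<le> K t" "\<And>t x. x \<in> M \<Longrightarrow> norm (Q t x) \<le> K t * norm x" by metis
  define L where "L = (\<Sum>t\<in>Poly_Mapping.keys q. real (e t) * K t)"
  have "bij_betw (poly3_op (dilate3 1 q) A B P) M M"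
  proof (rule bij_betw_continuation[where F = "\<lambda>r. poly3_op (dilate3 r q) A B P" and c = "1 / C" and L = L])
    fix r s :: real and x assume r: "r \<in> {0..1}" and s: "s \<in> {0..1}" and x: "x \<in> M"
    have "poly3_op (dilate3 s q) A B P x - poly3_op (dilate3 r q) A B P x
        = (\<Sum>t\<in>Poly_Mapping.keys q. of_real (s ^ e t - r ^ e t) *\<^sub>C Q t x)"
      by (simp add: F sum_subtractf[symmetric] scaleC.scale_left_diff_distrib)
    also have "norm \<dots> \<le> (\<Sum>t\<in>Poly_Mapping.keys q. \<bar>s - r\<bar> * norm x * (real (e t) * K t))"
    proof (rule sum_norm_le)
      fix t
      have "\<bar>s ^ e t - r ^ e t\<bar> \<le> real (e t) * \<bar>s - r\<bar>"
        using norm_power_diff[of s r "e t"] r s by (simp add: abs_le_iff)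
      hence "\<bar>s ^ e t - r ^ e t\<bar> * norm (Q t x) \<le> (real (e t) * \<bar>s - r\<bar>) * (K t * norm x)"
        using K(2)[OF x] by (intro mult_mono) auto
      thus "norm (of_real (s ^ e t - r ^ e t) *\<^sub>C Q t x) \<le> \<bar>s - r\<bar> * norm x * (real (e t) * K t)"
        by (simp only: norm_scaleC norm_of_real) (simp add: mult_ac)
    qed
    also have "\<dots> = L * \<bar>s - r\<bar> * norm x"
      unfolding L_def sum_distrib_left[symmetric] by (simp only: mult_ac)
    finally show "norm (poly3_op (dilate3 s q) A B P x - poly3_op (dilate3 r q) A B P x)
        \<le> L * \<bar>s - r\<bar> * norm x" .
  next
    fix r :: real and x
    assume r: "r \<in> {0..1}" and bij: "bij_betw (poly3_op (dilate3 r q) A B P) M M" and x: "x \<in> M"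
    have "norm x \<le> tetra_sup (affine3 1 0 0 0) (dilate3 r q) * norm (poly3_op (dilate3 r q) A B P x)"
      by (rule lower[OF tetra_dilate(1)[OF q r] bij x])
    also have "\<dots> \<le> C * norm (poly3_op (dilate3 r q) A B P x)"
      using tetra_dilate(2)[OF q r] by (intro mult_right_mono) (auto simp: C_def)
    finally show "1 / C * norm x \<le> norm (poly3_op (dilate3 r q) A B P x)"
      using C by (simp add: field_simps)
  next
    let ?c = "poly3_eval q (0, 0, 0)"
    have "?c \<noteq> 0" using q zero_in_closure_tetrablock by (auto simp: tetra_nonvanishing_def)
    hence "bij_betw (\<lambda>x. ?c *\<^sub>C x) M M" by (rule bij_betw_scaleC[OF M])
    thus "bij_betw (poly3_op (dilate3 0 q) A B P) M M" by (simp add: poly3_op_dilate_0[abs_def])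
  qed (use C bounded_op_poly3[OF triple] in auto)
  thus ?thesis by (simp add: poly3_op_dilate_1[abs_def])
qed

definition von_neumann_on ::
  "'a::complex_hilbert set \<Rightarrow> ('a \<Rightarrow> 'a) \<Rightarrow> ('a \<Rightarrow> 'a) \<Rightarrow> ('a \<Rightarrow> 'a) \<Rightarrow> bool" where
  "von_neumann_on M A B P \<longleftrightarrow> (\<forall>p q. tetra_nonvanishing q \<longrightarrow>
     (\<forall>x\<in>M. norm (poly3_op p A B P x) \<le> tetra_sup p q * norm (poly3_op q A B P x)))"

lemma von_neumann_bij_betw:
  assumes "commuting_triple_on M A B P" "von_neumann_on M A B P" "tetra_nonvanishing q"
  shows "bij_betw (poly3_op q A B P) M M"
proof (rule bij_betw_poly3_op[OF assms(1,3)])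
  show "norm x \<le> tetra_sup (affine3 1 0 0 0) q * norm (poly3_op q A B P x)"
    if "tetra_nonvanishing q" "x \<in> M" for q x
    using assms(2)[unfolded von_neumann_on_def, rule_format, OF that, of "affine3 1 0 0 0"] by simp
qed

text \<open>A point outside the closed tetrablock is a zero of some \<open>1 - z x\<^sub>1 - w x\<^sub>2 + z w x\<^sub>3\<close>
  that has no zero on it. As this function is affine, its value at the triple is a linear
  combination of the entries of the translated triple, and it is invertible.\<close>

lemma von_neumann_taylor_spectrum:
  assumes triple: "commuting_triple_on M A B P" and vN: "von_neumann_on M A B P"
  shows "taylor_spectrum_on M A B P \<subseteq> closure tetrablock"
proof (clarify, rule ccontr)
  fix a b c assume spec: "(a, b, c) \<in> taylor_spectrum_on M A B P"
    and out: "(a, b, c) \<notin> closure tetrablock"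
  note bounded = triple_bounded[OF triple]
  note M = bounded_op_csubspace[OF bounded(1)]
  obtain z w where z: "cmod z < 1" and w: "cmod w < 1" and zero: "1 - z * a - w * b + z * w * c = 0"
    using out unfolding closure_tetrablock_iff by blast
  let ?q = "affine3 1 (- z) (- w) (z * w)"
  have "tetra_nonvanishing ?q"
    unfolding tetra_nonvanishing_def
  proof clarify
    fix x1 x2 x3 assume "(x1, x2, x3) \<in> closure tetrablock"
    hence "1 - z * x1 - w * x2 + z * w * x3 \<noteq> 0" using z w by (simp add: closure_tetrablock_iff)
    moreover assume "poly3_eval ?q (x1, x2, x3) = 0"
    ultimately show False by simp
  qed
  hence "bij_betw (poly3_op ?q A B P) M M" by (rule von_neumann_bij_betw[OF triple vN])
  moreover have "poly3_op ?q A B P = (\<lambda>x. (- z) *\<^sub>C (A x - a *\<^sub>C x) + (- w) *\<^sub>C (B x - b *\<^sub>C x)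
      + (z * w) *\<^sub>C (P x - c *\<^sub>C x))"
  proof
    fix x
    have one: "z * a + w * b - z * w * c = 1" using zero by (simp add: algebra_simps)
    have "poly3_op ?q A B P x = (z * a + w * b - z * w * c) *\<^sub>C x
        + (- z) *\<^sub>C A x + (- w) *\<^sub>C B x + (z * w) *\<^sub>C P x"
      unfolding one by simp
    thus "poly3_op ?q A B P x = (- z) *\<^sub>C (A x - a *\<^sub>C x) + (- w) *\<^sub>C (B x - b *\<^sub>C x)
        + (z * w) *\<^sub>C (P x - c *\<^sub>C x)"
      by (simp add: scaleC.scale_right_diff_distrib scaleC.scale_left_distrib
          scaleC.scale_left_diff_distrib scaleC_scaleC)
  qed
  ultimately have "koszul_exact_on M (\<lambda>x. A x - a *\<^sub>C x) (\<lambda>x. B x - b *\<^sub>C x) (\<lambda>x. P x - c *\<^sub>C x)"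
  proof (intro koszul_exact_onI[where \<alpha> = "- z" and \<beta> = "- w" and \<gamma> = "z * w"])
    show "bounded_op_on M (\<lambda>x. A x - a *\<^sub>C x)" "bounded_op_on M (\<lambda>x. B x - b *\<^sub>C x)"
      "bounded_op_on M (\<lambda>x. P x - c *\<^sub>C x)"
      by (intro bounded_op_minus_op bounded_op_scale bounded bounded_op_ident M)+
  qed (simp_all add: bounded_op_diff[OF bounded(1)] bounded_op_diff[OF bounded(2)]
      bounded_op_diff[OF bounded(3)] bounded_op_scaleC[OF bounded(1)] bounded_op_scaleC[OF bounded(2)]
      bounded_op_scaleC[OF bounded(3)] bounded_op_in[OF bounded(1)] bounded_op_in[OF bounded(2)]
      bounded_op_in[OF bounded(3)] csubspace_scaleC[OF M] triple_commute[OF triple]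
      scaleC.scale_right_diff_distrib scaleC_scaleC mult.commute algebra_simps)
  thus False using spec by (simp add: taylor_spectrum_on_def)
qed

text \<open>This form of the definition mentions neither inverses nor the spectrum, so it passes to
  invariant subspaces by inspection.\<close>

theorem E_contraction_on_iff:
  "E_contraction_on M A B P \<longleftrightarrow> commuting_triple_on M A B P \<and> von_neumann_on M A B P"
proof (intro iffI conjI)
  assume E: "E_contraction_on M A B P"
  thus triple: "commuting_triple_on M A B P" by (simp add: E_contraction_on_def)
  have op: "norm (rational3_op_on M p q A B P y) \<le> tetra_sup p q * norm y"
    if "tetra_nonvanishing q" "y \<in> M" for p q y
    using E that
    by (simp add: E_contraction_on_def spectral_set_on_def tetra_nonvanishing_def tetra_sup_def op_norm_le_on_def)
  have vN: "norm (poly3_op p A B P x) \<le> tetra_sup p q * norm (poly3_op q A B P x)"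
    if q: "tetra_nonvanishing q" and bij: "bij_betw (poly3_op q A B P) M M" and x: "x \<in> M" for p q x
    using op[OF q bij_betw_apply[OF bij x], of p] bij x
    by (simp add: rational3_op_on_def bij_betw_def inv_into_f_f)
  have "bij_betw (poly3_op q A B P) M M" if "tetra_nonvanishing q" for q
    by (rule bij_betw_poly3_op[OF triple that]) (use vN[where p = "affine3 1 0 0 0"] in simp)
  thus "von_neumann_on M A B P" using vN by (simp add: von_neumann_on_def)
next
  assume "commuting_triple_on M A B P \<and> von_neumann_on M A B P"
  hence triple: "commuting_triple_on M A B P" and vN: "von_neumann_on M A B P" by auto
  have "norm (rational3_op_on M p q A B P y) \<le> tetra_sup p q * norm y"
    if q: "tetra_nonvanishing q" and y: "y \<in> M" for p q y
  proof -
    have "poly3_op q A B P ` M = M"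
      using von_neumann_bij_betw[OF triple vN q] by (simp add: bij_betw_def)
    hence "inv_into M (poly3_op q A B P) y \<in> M" "poly3_op q A B P (inv_into M (poly3_op q A B P) y) = y"
      using y by (auto intro: inv_into_into f_inv_into_f)
    thus ?thesis using vN q unfolding von_neumann_on_def rational3_op_on_def by metis
  qed
  thus "E_contraction_on M A B P"
    using triple von_neumann_taylor_spectrum[OF triple vN] compact_closure_tetrablock
    by (simp add: E_contraction_on_def spectral_set_on_def op_norm_le_on_def tetra_nonvanishing_def
        tetra_sup_def)
qed

lemma E_contraction_restrict:
  assumes "E_contraction_on M A B P" "joint_invariant_subspace A B P N" "N \<subseteq> M"
  shows "E_contraction_on N A B P"
  using assms triple_restrict[OF _ assms(2,3)]
  unfolding E_contraction_on_iff von_neumann_on_def by blast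

text \<open>With \<open>p'\<close>, \<open>q'\<close> the conjugated polynomials, write \<open>x = p(T\<^sup>*) u\<close> as \<open>q'(T) v\<close>. Then
  \<open>\<parallel>x\<parallel>\<^sup>2 = \<langle>q'(T) v, p(T\<^sup>*) u\<rangle> = \<langle>p'(T) v, q(T\<^sup>*) u\<rangle>\<close>, and the inequality for \<open>T\<close> bounds
  \<open>p'(T) v\<close> by \<open>q'(T) v = x\<close>.\<close>

lemma E_contraction_adj_on:
  assumes E: "E_contraction_on M A B P"
  shows "E_contraction_on M (adj_on M A) (adj_on M B) (adj_on M P)"
proof -
  have triple: "commuting_triple_on M A B P" and vN: "von_neumann_on M A B P"
    using E by (auto simp: E_contraction_on_iff)
  let ?p = "\<lambda>p. poly3_op p (adj_on M A) (adj_on M B) (adj_on M P)"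
  note triple' = triple_adj_on[OF triple]
  have "norm (?p p u) \<le> tetra_sup p q * norm (?p q u)" if q: "tetra_nonvanishing q" and u: "u \<in> M" for p q u
  proof -
    have q': "tetra_nonvanishing (conj_poly3 q)" using q by (simp add: tetra_conj)
    let ?x = "?p p u"
    have x: "?x \<in> M" by (rule bounded_op_in[OF bounded_op_poly3[OF triple'] u])
    then obtain v where v: "v \<in> M" "?x = poly3_op (conj_poly3 q) A B P v"
      using von_neumann_bij_betw[OF triple vN q'] by (metis bij_betw_imp_surj_on imageE)
    have pv: "poly3_op (conj_poly3 p) A B P v \<in> M"
      by (rule bounded_op_in[OF bounded_op_poly3[OF triple] v(1)])
    have "cinner ?x ?x = cinner (poly3_op (conj_poly3 p) A B P ?x) u"
      by (rule cinner_poly3_adj_on[OF triple x u, symmetric])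
    also have "\<dots> = cinner (poly3_op (conj_poly3 q) A B P (poly3_op (conj_poly3 p) A B P v)) u"
      unfolding v(2) by (simp add: poly3_op_commute_poly3[OF triple v(1)])
    also have "\<dots> = cinner (poly3_op (conj_poly3 p) A B P v) (?p q u)"
      by (rule cinner_poly3_adj_on[OF triple pv u])
    finally have "(norm ?x)\<^sup>2 = cmod (cinner (poly3_op (conj_poly3 p) A B P v) (?p q u))"
      by (metis cinner_self norm_of_real abs_of_nonneg zero_le_power2)
    also have "\<dots> \<le> norm (poly3_op (conj_poly3 p) A B P v) * norm (?p q u)"
      by (rule cmod_cinner_le)
    also have "\<dots> \<le> (tetra_sup p q * norm ?x) * norm (?p q u)"
      using vN[unfolded von_neumann_on_def, rule_format, OF q' v(1), of "conj_poly3 p"]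
      by (intro mult_right_mono) (simp_all add: tetra_conj(2) v(2))
    finally have "norm ?x * norm ?x \<le> norm ?x * (tetra_sup p q * norm (?p q u))"
      by (simp add: power2_eq_square mult_ac)
    thus ?thesis using tetra_sup_nonneg[OF q] by (cases "?x = 0") simp_all
  qed
  thus ?thesis using triple' by (simp add: E_contraction_on_iff von_neumann_on_def)
qed


section \<open>Isometries, unitaries and completely non-unitary contractions\<close>

lemma isometry_cinner:
  assumes T: "bounded_op_on M T" and iso: "\<And>x. x \<in> M \<Longrightarrow> norm (T x) = norm x"
    and x: "x \<in> M" and y: "y \<in> M"
  shows "cinner (T x) (T y) = cinner x y"
proof -
  note M = bounded_op_csubspace[OF T]
  have re: "Re (cinner (T x) (T y)) = Re (cinner x y)" if x: "x \<in> M" for x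
    using norm_add_sq[of "T x" "T y"] norm_add_sq[of x y] iso[OF x] iso[OF y]
      iso[OF csubspace_add[OF M x y]] bounded_op_add[OF T x y] by simp
  show ?thesis
    using re[OF x] re[OF csubspace_scaleC[OF M x, of \<i>]] bounded_op_scaleC[OF T x, of \<i>]
    by (simp add: complex_eq_iff cinner_scaleC_left)
qed

lemma
  assumes T: "bounded_op_on M T"
  shows zero_in_bounded_op_image: "0 \<in> T ` M"
    and add_in_bounded_op_image: "u \<in> T ` M \<Longrightarrow> v \<in> T ` M \<Longrightarrow> u + v \<in> T ` M"
    and scaleC_in_bounded_op_image: "u \<in> T ` M \<Longrightarrow> c *\<^sub>C u \<in> T ` M"
proof -
  note M = bounded_op_csubspace[OF T]
  show "0 \<in> T ` M" using bounded_op_zero[OF T] csubspace_zero[OF M] by (metis imageI)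
  show "u + v \<in> T ` M" if u: "u \<in> T ` M" and v: "v \<in> T ` M"
  proof -
    obtain x y where xy: "x \<in> M" "u = T x" "y \<in> M" "v = T y" using u v by blast
    hence "u + v = T (x + y)" by (simp add: bounded_op_add[OF T])
    thus ?thesis using csubspace_add[OF M xy(1,3)] by simp
  qed
  show "c *\<^sub>C u \<in> T ` M" if u: "u \<in> T ` M"
  proof -
    obtain x where x: "x \<in> M" "u = T x" using u by blast
    hence "c *\<^sub>C u = T (c *\<^sub>C x)" by (simp add: bounded_op_scaleC[OF T])
    thus ?thesis using csubspace_scaleC[OF M x(1)] by simp
  qed
qed

lemma csubspace_isometric_image:
  assumes T: "bounded_op_on M T" and iso: "\<And>x. x \<in> M \<Longrightarrow> norm (T x) = norm x"
  shows "closed_csubspace (T ` M)"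
proof -
  note M = bounded_op_csubspace[OF T]
  have "y \<in> T ` M" if Y: "\<And>n. Y n \<in> T ` M" and lim: "Y \<longlonglongrightarrow> y" for Y :: "nat \<Rightarrow> 'a" and y
  proof -
    have "\<forall>n. \<exists>x. x \<in> M \<and> Y n = T x" using Y by blast
    then obtain X where X: "\<And>n. X n \<in> M" "\<And>n. Y n = T (X n)" by metis
    have "norm (X m - X n) = norm (Y m - Y n)" for m n
      using iso[OF csubspace_diff[OF M X(1) X(1), of m n]]
      by (simp add: bounded_op_diff[OF T] X)
    hence "Cauchy X" using LIMSEQ_imp_Cauchy[OF lim] by (simp add: Cauchy_iff)
    then obtain x where x: "X \<longlonglongrightarrow> x" using Cauchy_convergent_iff convergent_def by blast
    have "x \<in> M" using closed_sequentially[OF csubspace_closed[OF M] _ x] X(1) by blast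
    moreover from this have "Y \<longlonglongrightarrow> T x"
      using bounded_op_tendsto[OF T X(1) x] by (simp flip: X(2))
    ultimately show ?thesis using LIMSEQ_unique[OF lim] by blast
  qed
  hence "closed (T ` M)" unfolding closed_sequential_limits by blast
  thus ?thesis
    using zero_in_bounded_op_image[OF T] add_in_bounded_op_image[OF T] scaleC_in_bounded_op_image[OF T]
    by (simp add: closed_csubspace_def)
qed

lemma csubspace_closure_image:
  assumes T: "bounded_op_on M T"
  shows "closed_csubspace (closure (T ` M))"
proof -
  note M = bounded_op_csubspace[OF T]
  have "u + v \<in> closure (T ` M)" if u: "u \<in> closure (T ` M)" and v: "v \<in> closure (T ` M)" for u v
  proof -
    obtain X Y where X: "\<And>n. X n \<in> T ` M" "X \<longlonglongrightarrow> u" and Y: "\<And>n. Y n \<in> T ` M" "Y \<longlonglongrightarrow> v"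
      using u v by (auto simp: closure_sequential)
    have "X n + Y n \<in> T ` M" for n
      by (rule add_in_bounded_op_image[OF T X(1) Y(1)])
    thus ?thesis
      using tendsto_add[OF X(2) Y(2)] unfolding closure_sequential
      by (intro exI[of _ "\<lambda>n. X n + Y n"]) auto
  qed
  moreover have "c *\<^sub>C u \<in> closure (T ` M)" if u: "u \<in> closure (T ` M)" for c u
  proof -
    obtain X where X: "\<And>n. X n \<in> T ` M" "X \<longlonglongrightarrow> u" using u by (auto simp: closure_sequential)
    have "c *\<^sub>C X n \<in> T ` M" for n
      by (rule scaleC_in_bounded_op_image[OF T X(1)])
    thus ?thesis
      using bounded_linear.tendsto[OF bounded_linear_scaleC X(2)] unfolding closure_sequential
      by (intro exI[of _ "\<lambda>n. c *\<^sub>C X n"]) auto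
  qed
  moreover have "0 \<in> closure (T ` M)" by (rule subsetD[OF closure_subset zero_in_bounded_op_image[OF T]])
  ultimately show ?thesis unfolding closed_csubspace_def using closed_closure by blast
qed

lemma unitary_onI:
  assumes U: "bounded_op_on N U" and iso: "\<And>x. x \<in> N \<Longrightarrow> norm (U x) = norm x" and surj: "U ` N = N"
  shows "unitary_on N U"
proof -
  have adj: "adj_on N U (U x) = x" if "x \<in> N" for x
    using that by (intro adj_on_eqI[OF U]) (auto simp: isometry_cinner[OF U iso] bounded_op_in[OF U])
  moreover have "U (adj_on N U y) = y" if "y \<in> N" for y
  proof -
    have "y \<in> U ` N" using that surj by simp
    then obtain x where "x \<in> N" "y = U x" by blast
    thus ?thesis by (simp add: adj)
  qed
  ultimately show ?thesis using U by (simp add: unitary_on_def)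
qed

lemma
  assumes U: "unitary_on N U"
  shows unitary_norm: "x \<in> N \<Longrightarrow> norm (U x) = norm x" and unitary_bij_betw: "bij_betw U N N"
proof -
  have b: "bounded_op_on N U" and adj: "\<And>x. x \<in> N \<Longrightarrow> adj_on N U (U x) = x"
    and adj': "\<And>x. x \<in> N \<Longrightarrow> U (adj_on N U x) = x"
    using U by (auto simp: unitary_on_def)
  show "norm (U x) = norm x" if x: "x \<in> N"
  proof -
    have "cinner (U x) (U x) = cinner x x"
      using cinner_adj_on[OF b bounded_op_in[OF b x] x] adj[OF x] by simp
    hence "(norm (U x))\<^sup>2 = (norm x)\<^sup>2" by (simp only: cinner_self of_real_eq_iff)
    thus ?thesis by simp
  qed
  show "bij_betw U N N"
    by (rule bij_betw_byWitness[where f' = "adj_on N U"])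
      (use adj adj' bounded_op_in[OF b] adj_on_in[OF b] in auto)
qed

lemma contraction_adj_on:
  assumes "contraction_on M P" shows "contraction_on M (adj_on M P)"
proof -
  have P: "bounded_op_on M P" and le: "\<And>x. x \<in> M \<Longrightarrow> norm (P x) \<le> 1 * norm x"
    using assms by (auto simp: contraction_on_def op_norm_le_on_def)
  show ?thesis
    using bounded_op_adj_on[OF P] norm_adj_on_le[OF P _ le]
    by (simp add: contraction_on_def op_norm_le_on_def)
qed

text \<open>Equality in the Cauchy-Schwarz inequality \<open>\<parallel>x\<parallel>\<^sup>2 = \<langle>x, T\<^sup>*T x\<rangle> \<le> \<parallel>x\<parallel> \<parallel>T\<^sup>*T x\<parallel>\<close>.\<close>

lemma contraction_adj_on_isometric:
  assumes T: "contraction_on M T" and x: "x \<in> M" and iso: "norm (T x) = norm x"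
  shows "adj_on M T (T x) = x"
proof -
  have b: "bounded_op_on M T" and b': "contraction_on M (adj_on M T)"
    using T contraction_adj_on[OF T] by (auto simp: contraction_on_def)
  have Tx: "T x \<in> M" by (rule bounded_op_in[OF b x])
  have "cinner x (adj_on M T (T x)) = cinner (T x) (T x)" by (rule cinner_adj_on[OF b Tx x, symmetric])
  hence "Re (cinner x (adj_on M T (T x))) = (norm x)\<^sup>2" by (simp add: cinner_self iso)
  moreover have "norm (adj_on M T (T x)) \<le> norm x"
    using b' Tx iso by (auto simp: contraction_on_def op_norm_le_on_def)
  hence "(norm (adj_on M T (T x)))\<^sup>2 \<le> (norm x)\<^sup>2" by (rule power_mono) simp
  ultimately have "(norm (x - adj_on M T (T x)))\<^sup>2 \<le> 0" by (simp add: norm_diff_sq)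
  thus ?thesis by simp
qed

text \<open>By the previous lemma \<open>P\<^sup>*\<close> inverts \<open>P\<close> on \<open>N\<close>. So a unitary restriction of a c.n.u.
  contraction to any closed invariant subspace is trivial, reducing or not; this makes being c.n.u.
  inherited by invariant subspaces.\<close>

lemma unitary_part_reducing:
  assumes P: "contraction_on M P" and N: "N \<subseteq> M" and U: "unitary_on N P"
  shows "reducing_on M P N"
proof -
  have b: "bounded_op_on N P" using U by (simp add: unitary_on_def)
  have "adj_on M P y \<in> N" if "y \<in> N" for y
  proof -
    have "y \<in> P ` N" using that bij_betw_imp_surj_on[OF unitary_bij_betw[OF U]] by simp
    then obtain x where x: "x \<in> N" "y = P x" by blast
    thus ?thesis using contraction_adj_on_isometric[OF P _ unitary_norm[OF U x(1)]] N by auto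
  qed
  thus ?thesis using N b by (auto simp: reducing_on_def invariant_subspace_def bounded_op_on_def)
qed

lemma cnu_unitary_trivial:
  assumes "cnu_on M P" "N \<subseteq> M" "unitary_on N P"
  shows "N = {0}"
  using assms unitary_part_reducing unfolding cnu_on_def by blast

lemma cnu_restrict:
  assumes cnu: "cnu_on M P" and inv: "invariant_subspace P N" and N: "N \<subseteq> M"
  shows "cnu_on N P"
proof -
  have "contraction_on N P"
    using cnu inv N bounded_op_restrict[of M P N]
    by (auto simp: cnu_on_def contraction_on_def op_norm_le_on_def invariant_subspace_def)
  moreover have "N' = {0}" if "reducing_on N P N'" "unitary_on N' P" for N'
    using cnu_unitary_trivial[OF cnu _ that(2)] that(1) N by (auto simp: reducing_on_def)
  ultimately show ?thesis by (auto simp: cnu_on_def)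
qed

lemma cnu_adj_on:
  assumes cnu: "cnu_on M P"
  shows "cnu_on M (adj_on M P)"
proof -
  let ?Q = "adj_on M P"
  have P: "contraction_on M P" using cnu by (simp add: cnu_on_def)
  hence b: "bounded_op_on M P" by (simp add: contraction_on_def)
  have "N = {0}" if red: "reducing_on M ?Q N" and U: "unitary_on N ?Q" for N
  proof -
    have N: "N \<subseteq> M" "closed_csubspace N" using red by (auto simp: reducing_on_def invariant_subspace_def)
    have PN: "P x \<in> N" if "x \<in> N" for x
    proof -
      have "adj_on M ?Q x \<in> N" using red that by (auto simp: reducing_on_def invariant_subspace_def)
      thus ?thesis using adj_on_adj_on[OF b] N that by auto
    qed
    have bN: "bounded_op_on N P" using bounded_op_restrict[OF b N(2,1)] PN by auto
    have bQ: "bounded_op_on N ?Q" using U by (simp add: unitary_on_def)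
    \<comment> \<open>On \<open>N\<close> the two operators are inverse to each other.\<close>
    have PQ: "P y = adj_on N ?Q y" if "y \<in> N" for y
      using that N PN cinner_adj_on'[OF b]
      by (intro adj_on_eqI[OF bQ, symmetric]) (auto simp: subset_iff)
    have "P (?Q x) = x" "?Q (P x) = x" if "x \<in> N" for x
      using that U bounded_op_in[OF bQ that] by (simp_all add: PQ unitary_on_def)
    hence "bij_betw P N N"
      using PN bounded_op_in[OF bQ] by (intro bij_betw_byWitness[where f' = ?Q]) auto
    moreover have "norm (P x) = norm x" if "x \<in> N" for x
      using unitary_norm[OF U PN[OF that]] \<open>\<And>x. x \<in> N \<Longrightarrow> ?Q (P x) = x\<close>[OF that] by simp
    ultimately have "unitary_on N P" using bN by (intro unitary_onI) (auto simp: bij_betw_def)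
    thus ?thesis by (rule cnu_unitary_trivial[OF cnu N(1)])
  qed
  thus ?thesis using contraction_adj_on[OF P] by (auto simp: cnu_on_def)
qed

text \<open>As \<open>S\<close> kills the wandering subspace \<open>M \<ominus> P M\<close>, we have \<open>S M = S P M = P S M\<close>. Hence \<open>P\<close> is
  unitary on the closure of \<open>S M\<close>, which must be zero.\<close>

lemma cnu_isometry_annihilates:
  assumes cnu: "cnu_on M P" and iso: "\<And>x. x \<in> M \<Longrightarrow> norm (P x) = norm x"
    and S: "bounded_op_on M S" and SP: "\<And>x. x \<in> M \<Longrightarrow> S (P x) = P (S x)"
    and wandering: "\<And>e. e \<in> M \<Longrightarrow> (\<And>x. x \<in> M \<Longrightarrow> cinner (P x) e = 0) \<Longrightarrow> S e = 0"
    and x: "x \<in> M"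
  shows "S x = 0"
proof -
  have P: "bounded_op_on M P" using cnu by (simp add: cnu_on_def contraction_on_def)
  note M = bounded_op_csubspace[OF P]
  let ?N = "closure (S ` M)"
  have N: "closed_csubspace ?N" by (rule csubspace_closure_image[OF S])
  have SM: "S ` M \<subseteq> M" using bounded_op_in[OF S] by blast
  hence NM: "?N \<subseteq> M" by (rule closure_minimal) (rule csubspace_closed[OF M])
  have PN: "P ` ?N \<subseteq> ?N"
  proof clarify
    fix y assume y: "y \<in> ?N"
    then obtain Y where Y: "\<And>n. Y n \<in> S ` M" "Y \<longlonglongrightarrow> y" by (auto simp: closure_sequential)
    have "P (Y n) \<in> S ` M" for n
    proof -
      obtain v where v: "v \<in> M" "Y n = S v" using Y(1)[of n] by blast
      thus ?thesis using SP[OF v(1)] bounded_op_in[OF P v(1)] by (auto intro!: image_eqI[of _ S "P v"])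
    qed
    moreover have "(\<lambda>n. P (Y n)) \<longlonglongrightarrow> P y"
      by (rule bounded_op_tendsto[OF P]) (use Y y NM SM in auto)
    ultimately show "P y \<in> ?N"
      unfolding closure_sequential by (intro exI[of _ "\<lambda>n. P (Y n)"]) auto
  qed
  have bN: "bounded_op_on ?N P" by (rule bounded_op_restrict[OF P N NM PN])
  have "S ` M \<subseteq> P ` ?N"
  proof clarify
    fix u assume u: "u \<in> M"
    obtain v where v: "v \<in> M" "\<And>w. w \<in> M \<Longrightarrow> cinner (P w) (u - P v) = 0"
      using orthogonal_projection_exists[OF csubspace_isometric_image[OF P iso], of u] by auto
    have Pv: "P v \<in> M" by (rule bounded_op_in[OF P v(1)])
    have "S (u - P v) = 0" by (rule wandering) (use v csubspace_diff[OF M u Pv] in auto)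
    hence "S u = P (S v)" using SP[OF v(1)] by (simp add: bounded_op_diff[OF S u Pv])
    thus "S u \<in> P ` ?N" using v(1) closure_subset by blast
  qed
  hence "?N \<subseteq> P ` ?N"
    using csubspace_closed[OF csubspace_isometric_image[OF bN]] iso NM
    by (intro closure_minimal) auto
  hence "unitary_on ?N P" using PN iso NM by (intro unitary_onI[OF bN]) auto
  hence "?N = {0}" by (rule cnu_unitary_trivial[OF cnu NM])
  thus ?thesis using subsetD[OF closure_subset imageI[OF x, of S]] by simp
qed


section \<open>The decomposition of a contraction\<close>

lemma contraction_pow:
  assumes "contraction_on M P" shows "contraction_on M (P ^^ n)"
proof -
  have P: "bounded_op_on M P" and le: "\<And>x. x \<in> M \<Longrightarrow> norm (P x) \<le> norm x"
    using assms by (auto simp: contraction_on_def op_norm_le_on_def)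
  have "norm ((P ^^ n) x) \<le> norm x" if "x \<in> M" for x
  proof (induction n)
    case (Suc n)
    then show ?case using le[OF bounded_op_in[OF bounded_op_pow[OF P] that, of n]] by simp
  qed simp
  thus ?thesis using bounded_op_pow[OF P] by (simp add: contraction_on_def op_norm_le_on_def)
qed

lemma csubspace_decomp_H1:
  assumes "contraction_on UNIV P" shows "closed_csubspace (decomp_H1 P)"
proof -
  have P: "bounded_op_on UNIV (P ^^ n)" and le: "norm ((P ^^ n) x) \<le> norm x" for n x
    using contraction_pow[OF assms, of n] by (auto simp: contraction_on_def op_norm_le_on_def)
  have "x \<in> decomp_H1 P" if x: "x \<in> closure (decomp_H1 P)" for x
    unfolding decomp_H1_def mem_Collect_eq
  proof (rule LIMSEQ_I)
    fix e :: real assume "0 < e"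
    then obtain y where y: "y \<in> decomp_H1 P" "dist y x < e / 2"
      using x unfolding closure_approachable by (meson half_gt_zero)
    obtain N where N: "\<And>n. n \<ge> N \<Longrightarrow> norm ((P ^^ n) y) < e / 2"
      using y(1) \<open>0 < e\<close> LIMSEQ_D[of "\<lambda>k. norm ((P ^^ k) y)" 0 "e / 2"]
      by (auto simp: decomp_H1_def)
    have "norm ((P ^^ n) x) < e" if "n \<ge> N" for n
    proof -
      have "(P ^^ n) x = (P ^^ n) (x - y) + (P ^^ n) y" by (simp add: bounded_op_diff[OF P])
      hence "norm ((P ^^ n) x) \<le> norm ((P ^^ n) (x - y)) + norm ((P ^^ n) y)"
        by (metis norm_triangle_ineq)
      also have "\<dots> < e / 2 + e / 2"
        using le[of n "x - y"] y(2) N[OF that] by (intro add_strict_mono) (auto simp: dist_norm norm_minus_commute)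
      finally show ?thesis by simp
    qed
    thus "\<exists>N. \<forall>n\<ge>N. norm (norm ((P ^^ n) x) - 0) < e" by auto
  qed
  hence "closed (decomp_H1 P)" using closure_subset_eq by blast
  moreover have "x + y \<in> decomp_H1 P" if "x \<in> decomp_H1 P" "y \<in> decomp_H1 P" for x y
    using that tendsto_add[of "\<lambda>k. (P ^^ k) x" 0 _ "\<lambda>k. (P ^^ k) y" 0]
    by (simp add: decomp_H1_def tendsto_norm_zero_iff bounded_op_add[OF P])
  moreover have "c *\<^sub>C x \<in> decomp_H1 P" if "x \<in> decomp_H1 P" for c x
    using that tendsto_mult_right_zero[of "\<lambda>k. norm ((P ^^ k) x)" _ "cmod c"]
    by (simp add: decomp_H1_def bounded_op_scaleC[OF P] norm_scaleC)
  ultimately show ?thesis by (simp add: closed_csubspace_def decomp_H1_def bounded_op_zero[OF P])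
qed

lemma decomp_H1_invariant:
  assumes S: "bounded_op_on UNIV S" and SP: "\<And>x. S (P x) = P (S x)"
  shows "S ` decomp_H1 P \<subseteq> decomp_H1 P"
proof clarify
  fix x assume x: "x \<in> decomp_H1 P"
  obtain K where K: "\<And>x. norm (S x) \<le> K * norm x" using bounded_op_bound[OF S] by auto
  have "(P ^^ k) (S x) = S ((P ^^ k) x)" for k
    using pow_commute[of P UNIV S x k] SP by simp
  hence "norm (norm ((P ^^ k) (S x))) \<le> norm (norm ((P ^^ k) x)) * K" for k
    using K by (simp add: mult.commute)
  thus "S x \<in> decomp_H1 P"
    using x unfolding decomp_H1_def by (auto intro: tendsto_0_le[where K = K])
qed

text \<open>The norm condition becomes linear: \<open>decomp_H3 P\<close> is the joint fixed space of the operators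
  \<open>P\<^sup>*\<^sup>k P\<^sup>k\<close>.\<close>

lemma decomp_H3_iff:
  assumes P: "contraction_on UNIV P"
  shows "x \<in> decomp_H3 P \<longleftrightarrow> (\<forall>k. adj (P ^^ k) ((P ^^ k) x) = x)"
proof -
  have b: "bounded_op_on UNIV (P ^^ n)" and le: "norm ((P ^^ n) x) \<le> norm x" for n x
    using contraction_pow[OF P, of n] by (auto simp: contraction_on_def op_norm_le_on_def)
  have iso: "norm ((P ^^ k) x) = norm x" if x: "x \<in> decomp_H3 P" for k
  proof (rule antisym[OF le])
    have "decseq (\<lambda>k. norm ((P ^^ k) x))"
      by (intro decseq_SucI) (use le[of 1] in simp)
    thus "norm x \<le> norm ((P ^^ k) x)" using x by (intro decseq_ge) (auto simp: decomp_H3_def)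
  qed
  have iso': "norm ((P ^^ k) x) = norm x" if "adj (P ^^ k) ((P ^^ k) x) = x" for k
  proof -
    have "cinner ((P ^^ k) x) ((P ^^ k) x) = cinner x x" by (simp add: cinner_adj_on[OF b] that)
    hence "(norm ((P ^^ k) x))\<^sup>2 = (norm x)\<^sup>2" by (simp only: cinner_self of_real_eq_iff)
    thus ?thesis by simp
  qed
  show ?thesis
  proof (intro iffI allI)
    show "adj (P ^^ k) ((P ^^ k) x) = x" if "x \<in> decomp_H3 P" for k
      by (rule contraction_adj_on_isometric[OF contraction_pow[OF P]]) (simp_all add: iso that)
  next
    assume "\<forall>k. adj (P ^^ k) ((P ^^ k) x) = x"
    hence "norm ((P ^^ k) x) = norm x" for k using iso' by blast
    thus "x \<in> decomp_H3 P" by (simp add: decomp_H3_def)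
  qed
qed

lemma csubspace_decomp_H3:
  assumes P: "contraction_on UNIV P" shows "closed_csubspace (decomp_H3 P)"
proof -
  define T where "T k x = adj (P ^^ k) ((P ^^ k) x)" for k x
  have T: "bounded_op_on UNIV (T k)" for k
    using contraction_pow[OF P, of k] bounded_op_comp[OF bounded_op_adj_on, of UNIV "P ^^ k" "P ^^ k"]
    by (simp add: T_def[abs_def] contraction_on_def)
  have H3: "x \<in> decomp_H3 P \<longleftrightarrow> (\<forall>k. T k x = x)" for x by (simp add: decomp_H3_iff[OF P] T_def)
  have "closed (decomp_H3 P)"
    unfolding closed_sequential_limits
  proof (intro allI impI, elim conjE)
    fix X x assume X: "\<forall>n. X n \<in> decomp_H3 P" and lim: "X \<longlonglongrightarrow> x"
    have "T k x = x" for k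
    proof (rule LIMSEQ_unique)
      show "(\<lambda>n. T k (X n)) \<longlonglongrightarrow> T k x" by (rule bounded_op_tendsto[OF T _ lim]) auto
      show "(\<lambda>n. T k (X n)) \<longlonglongrightarrow> x" using X lim by (simp add: H3)
    qed
    thus "x \<in> decomp_H3 P" by (simp add: H3)
  qed
  thus ?thesis
    by (simp add: closed_csubspace_def H3 bounded_op_zero[OF T] bounded_op_add[OF T] bounded_op_scaleC[OF T])
qed

text \<open>As both \<open>S\<close> and \<open>S\<^sup>*\<close> commute with \<open>P\<close>, the operator \<open>S\<close> commutes with all \<open>P\<^sup>*\<^sup>k P\<^sup>k\<close>.\<close>

lemma decomp_H3_invariant:
  assumes P: "contraction_on UNIV P" and S: "bounded_op_on UNIV S"
    and SP: "\<And>x. S (P x) = P (S x)" and adjSP: "\<And>x. adj S (P x) = P (adj S x)"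
  shows "S ` decomp_H3 P \<subseteq> decomp_H3 P"
proof clarify
  fix x assume x: "x \<in> decomp_H3 P"
  have bP: "bounded_op_on UNIV (P ^^ k)" for k using contraction_pow[OF P, of k] by (simp add: contraction_on_def)
  have "adj (P ^^ k) ((P ^^ k) (S x)) = S x" for k
  proof -
    have "S (adj (P ^^ k) y) = adj (P ^^ k) (S y)" for y
      using adj_on_comp_commute[OF bounded_op_adj_on[OF S] bP, of k y] pow_commute[of P UNIV "adj S" _ k]
        adjSP adj_on_adj_on[OF S] by simp
    moreover have "(P ^^ k) (S x) = S ((P ^^ k) x)" using pow_commute[of P UNIV S x k] SP by simp
    ultimately have "adj (P ^^ k) ((P ^^ k) (S x)) = S (adj (P ^^ k) ((P ^^ k) x))" by simp
    thus ?thesis using x by (simp add: decomp_H3_iff[OF P])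
  qed
  thus "S x \<in> decomp_H3 P" by (simp add: decomp_H3_iff[OF P])
qed

lemma norm_decomp_H3:
  assumes P: "contraction_on UNIV P" and x: "x \<in> decomp_H3 P"
  shows "norm (P x) = norm x"
proof -
  have b: "bounded_op_on UNIV P" using P by (simp add: contraction_on_def)
  have "adj (P ^^ 1) ((P ^^ 1) x) = x" using x decomp_H3_iff[OF P] by blast
  hence "cinner (P x) (P x) = cinner x x" by (simp add: cinner_adj_on[OF b])
  hence "(norm (P x))\<^sup>2 = (norm x)\<^sup>2" by (simp only: cinner_self of_real_eq_iff)
  thus ?thesis by simp
qed

lemma decomp_H3_invariant_self:
  assumes P: "contraction_on UNIV P"
  shows "P ` decomp_H3 P \<subseteq> decomp_H3 P"
proof clarify
  fix x assume x: "x \<in> decomp_H3 P"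
  have "(\<lambda>k. norm ((P ^^ Suc k) x)) \<longlonglongrightarrow> norm x"
    by (rule LIMSEQ_Suc) (use x in \<open>simp add: decomp_H3_def\<close>)
  thus "P x \<in> decomp_H3 P"
    using norm_decomp_H3[OF P x] by (simp add: decomp_H3_def funpow_swap1)
qed

lemma adj_orth_compl_invariant:
  assumes T: "bounded_op_on UNIV T" and S: "T ` S \<subseteq> S"
  shows "adj T ` orth_compl S \<subseteq> orth_compl S"
  using S by (auto simp: orth_compl_def cinner_adj_on'[OF T, symmetric])


section \<open>E-contractions with isometric last entry\<close>

text \<open>On the closed tetrablock \<open>\<bar>x\<^sub>1 - z x\<^sub>3\<bar> \<le> \<bar>1 - z x\<^sub>2\<bar>\<close> for \<open>\<bar>z\<bar> \<le> 1\<close>, and the same holds with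
  \<open>x\<^sub>1\<close> and \<open>x\<^sub>2\<close> exchanged. The von Neumann inequality applies to the quotient when
  \<open>\<bar>z\<bar> < 1\<close>, as the denominator then has no zero.\<close>

lemma E_contraction_pencil:
  assumes E: "E_contraction_on M A B P" and x: "x \<in> M" and z: "cmod z \<le> 1"
  shows "norm (A x - z *\<^sub>C P x) \<le> norm (x - z *\<^sub>C B x)"
    and "norm (B x - z *\<^sub>C P x) \<le> norm (x - z *\<^sub>C A x)"
proof -
  have vN: "von_neumann_on M A B P" using E by (simp add: E_contraction_on_iff)
  have bound: "norm (poly3_op p A B P x) \<le> norm (poly3_op q A B P x)"
    if q: "tetra_nonvanishing q"
      and le: "\<And>z. z \<in> closure tetrablock \<Longrightarrow> cmod (poly3_eval p z) \<le> cmod (poly3_eval q z)" for p q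
  proof -
    have "tetra_sup p q \<le> 1"
      using q le by (intro tetra_sup_least) (auto simp: norm_divide tetra_nonvanishing_def divide_le_eq_1)
    hence "tetra_sup p q * norm (poly3_op q A B P x) \<le> 1 * norm (poly3_op q A B P x)"
      by (rule mult_right_mono) simp
    thus ?thesis
      using vN[unfolded von_neumann_on_def, rule_format, OF q x, of p] by linarith
  qed
  have ne: "1 - z * x1 \<noteq> 0" "1 - z * x2 \<noteq> 0"
    if "cmod z < 1" "(x1, x2, x3) \<in> closure tetrablock" for z x1 x2 x3
  proof -
    have "1 - z * x1 - 0 * x2 + z * 0 * x3 \<noteq> 0" "1 - 0 * x1 - z * x2 + 0 * z * x3 \<noteq> 0"
      using that unfolding closure_tetrablock_iff by (metis norm_zero zero_less_one)+
    thus "1 - z * x1 \<noteq> 0" "1 - z * x2 \<noteq> 0" by auto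
  qed
  have open_disc: "norm (A x - z *\<^sub>C P x) \<le> norm (x - z *\<^sub>C B x)
      \<and> norm (B x - z *\<^sub>C P x) \<le> norm (x - z *\<^sub>C A x)" if z: "cmod z < 1" for z
  proof
    have "norm (poly3_op (affine3 0 1 0 (- z)) A B P x) \<le> norm (poly3_op (affine3 1 0 (- z) 0) A B P x)"
    proof (rule bound)
      show "tetra_nonvanishing (affine3 1 0 (- z) 0)" using ne(2)[OF z] by (auto simp: tetra_nonvanishing_def)
      show "cmod (poly3_eval (affine3 0 1 0 (- z)) y) \<le> cmod (poly3_eval (affine3 1 0 (- z) 0) y)"
        if "y \<in> closure tetrablock" for y
        using that closure_tetrablock_bounds(1)[OF closure_tetrablock_swap, of _ _ _ z] z
        by (cases y) auto
    qed
    thus "norm (A x - z *\<^sub>C P x) \<le> norm (x - z *\<^sub>C B x)" by simp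
    have "norm (poly3_op (affine3 0 0 1 (- z)) A B P x) \<le> norm (poly3_op (affine3 1 (- z) 0 0) A B P x)"
    proof (rule bound)
      show "tetra_nonvanishing (affine3 1 (- z) 0 0)" using ne(1)[OF z] by (auto simp: tetra_nonvanishing_def)
      show "cmod (poly3_eval (affine3 0 0 1 (- z)) y) \<le> cmod (poly3_eval (affine3 1 (- z) 0 0) y)"
        if "y \<in> closure tetrablock" for y
        using that closure_tetrablock_bounds(1)[of _ _ _ z] z by (cases y) auto
    qed
    thus "norm (B x - z *\<^sub>C P x) \<le> norm (x - z *\<^sub>C A x)" by simp
  qed
  have cont: "continuous_on UNIV (\<lambda>z. norm (u - z *\<^sub>C v))" for u v :: 'a
  proof -
    have "bounded_linear (\<lambda>z. z *\<^sub>C v)"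
      by (rule bounded_linear_intro[where K = "norm v"])
        (auto simp: scaleC_add_left norm_scaleC scaleC_of_real[symmetric] scaleC_scaleC scaleR_conv_of_real)
    thus ?thesis by (intro continuous_intros linear_continuous_on)
  qed
  have "ball 0 1 \<subseteq> {z. norm (A x - z *\<^sub>C P x) \<le> norm (x - z *\<^sub>C B x)}
      \<inter> {z. norm (B x - z *\<^sub>C P x) \<le> norm (x - z *\<^sub>C A x)}"
    using open_disc by auto
  hence "closure (ball 0 1) \<subseteq> {z. norm (A x - z *\<^sub>C P x) \<le> norm (x - z *\<^sub>C B x)}
      \<inter> {z. norm (B x - z *\<^sub>C P x) \<le> norm (x - z *\<^sub>C A x)}"
    by (rule closure_minimal) (intro closed_Int closed_Collect_le cont)
  moreover have "z \<in> closure (ball 0 1)" using z by simp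
  ultimately show "norm (A x - z *\<^sub>C P x) \<le> norm (x - z *\<^sub>C B x)"
    and "norm (B x - z *\<^sub>C P x) \<le> norm (x - z *\<^sub>C A x)" by auto
qed

lemma eq_0_if_Re_rotations_nonneg:
  assumes "\<And>z. cmod z = 1 \<Longrightarrow> 0 \<le> Re (z * u)" shows "u = 0"
  using assms[of 1] assms[of "-1"] assms[of \<i>] assms[of "- \<i>"] by (simp add: complex_eq_iff)

text \<open>Expanding the squares for \<open>\<bar>z\<bar> = 1\<close> gives
  \<open>\<parallel>A x\<parallel>\<^sup>2 - \<parallel>B x\<parallel>\<^sup>2 \<le> 2 Re (z (\<langle>P x, A x\<rangle> - \<langle>B x, x\<rangle>))\<close> and its twin with \<open>A\<close> and \<open>B\<close> exchanged.
  Averaging over \<open>z\<close> and \<open>-z\<close> shows that the left-hand sides vanish.\<close>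

lemma E_contraction_isometry_cinner:
  assumes E: "E_contraction_on M A B P" and x: "x \<in> M" and iso: "norm (P x) = norm x"
  shows "cinner (P x) (A x) = cinner (B x) x" and "cinner (P x) (B x) = cinner (A x) x"
proof -
  define u where "u = cinner (P x) (A x) - cinner (B x) x"
  define v where "v = cinner (P x) (B x) - cinner (A x) x"
  have sq: "(norm (C x - z *\<^sub>C P x))\<^sup>2 = (norm (C x))\<^sup>2 + (norm x)\<^sup>2 - 2 * Re (z * cinner (P x) (C x))"
    "(norm (x - z *\<^sub>C C x))\<^sup>2 = (norm x)\<^sup>2 + (norm (C x))\<^sup>2 - 2 * Re (z * cinner (C x) x)"
    if "cmod z = 1" for z and C :: "'a \<Rightarrow> 'a"
    using norm_diff_sq[of "z *\<^sub>C P x" "C x"] norm_diff_sq[of "z *\<^sub>C C x" x] that iso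
    by (simp_all add: norm_minus_commute norm_scaleC cinner_scaleC_left)
  have u: "(norm (A x))\<^sup>2 - (norm (B x))\<^sup>2 \<le> 2 * Re (z * u)"
    and v: "(norm (B x))\<^sup>2 - (norm (A x))\<^sup>2 \<le> 2 * Re (z * v)" if z: "cmod z = 1" for z
  proof -
    have "(norm (A x - z *\<^sub>C P x))\<^sup>2 \<le> (norm (x - z *\<^sub>C B x))\<^sup>2"
      "(norm (B x - z *\<^sub>C P x))\<^sup>2 \<le> (norm (x - z *\<^sub>C A x))\<^sup>2"
      using E_contraction_pencil[OF E x, of z] z by (auto intro!: power_mono)
    thus "(norm (A x))\<^sup>2 - (norm (B x))\<^sup>2 \<le> 2 * Re (z * u)"
      "(norm (B x))\<^sup>2 - (norm (A x))\<^sup>2 \<le> 2 * Re (z * v)"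
      unfolding sq[OF z] u_def v_def right_diff_distrib minus_complex.sel by linarith+
  qed
  have "(norm (A x))\<^sup>2 - (norm (B x))\<^sup>2 \<le> 2 * Re u" "(norm (A x))\<^sup>2 - (norm (B x))\<^sup>2 \<le> - (2 * Re u)"
    "(norm (B x))\<^sup>2 - (norm (A x))\<^sup>2 \<le> 2 * Re v" "(norm (B x))\<^sup>2 - (norm (A x))\<^sup>2 \<le> - (2 * Re v)"
    using u[of 1] u[of "-1"] v[of 1] v[of "-1"] by simp_all
  hence "(norm (A x))\<^sup>2 = (norm (B x))\<^sup>2" by linarith
  hence "u = 0" "v = 0" using u v by (auto intro!: eq_0_if_Re_rotations_nonneg)
  thus "cinner (P x) (A x) = cinner (B x) x" "cinner (P x) (B x) = cinner (A x) x"
    by (auto simp: u_def v_def)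
qed

lemma eq_0_if_cinner_self_0:
  assumes T: "bounded_op_on M T" and zero: "\<And>x. x \<in> M \<Longrightarrow> cinner (T x) x = 0" and x: "x \<in> M"
  shows "T x = 0"
proof -
  note M = bounded_op_csubspace[OF T]
  have polar: "cinner (T x) y + cinner (T y) x = 0" if "x \<in> M" "y \<in> M" for x y
    using zero[OF csubspace_add[OF M that]] zero[OF that(1)] zero[OF that(2)]
    by (simp add: bounded_op_add[OF T that] cinner_add_left cinner_add_right add.commute)
  have "cinner (T x) y = 0" if y: "y \<in> M" for y
  proof -
    have "\<i> * (cinner (T y) x - cinner (T x) y) = 0"
      using polar[OF x csubspace_scaleC[OF M y, of \<i>]]
      by (simp add: bounded_op_scaleC[OF T y] cinner_scaleC_left cinner_scaleC_right algebra_simps)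
    thus ?thesis using polar[OF x y] by simp
  qed
  thus ?thesis using bounded_op_in[OF T x] by (metis cinner_self_eq_0_iff)
qed

text \<open>Polarisation turns the scalar identities into \<open>A\<^sup>*P = B\<close> and \<open>B\<^sup>*P = A\<close>. If \<open>P\<close> commutes
  with \<open>A\<^sup>*\<close> and \<open>B\<^sup>*\<close>, then \<open>A = P B\<^sup>*\<close> and \<open>B = P A\<^sup>*\<close> have their ranges in \<open>P M\<close>, so \<open>A\<^sup>*\<close> and \<open>B\<^sup>*\<close>
  kill the wandering subspace of \<open>P\<close>.\<close>

lemma E_contraction_cnu_isometry_zero:
  assumes E: "E_contraction_on M A B P" and cnu: "cnu_on M P"
    and iso: "\<And>x. x \<in> M \<Longrightarrow> norm (P x) = norm x"
    and AP: "\<And>x. x \<in> M \<Longrightarrow> adj_on M A (P x) = P (adj_on M A x)"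
    and BP: "\<And>x. x \<in> M \<Longrightarrow> adj_on M B (P x) = P (adj_on M B x)"
    and x: "x \<in> M"
  shows "A x = 0" and "B x = 0"
proof -
  have triple: "commuting_triple_on M A B P" using E by (simp add: E_contraction_on_iff)
  note b = triple_bounded[OF triple]
  have A: "A x = P (adj_on M B x)" and B: "B x = P (adj_on M A x)" if x: "x \<in> M" for x
  proof -
    have "adj_on M B (P x) - A x = 0"
    proof (rule eq_0_if_cinner_self_0[OF bounded_op_minus_op[OF bounded_op_comp[OF bounded_op_adj_on[OF b(2)] b(3)] b(1)] _ x])
      show "cinner (adj_on M B (P y) - A y) y = 0" if "y \<in> M" for y
        using E_contraction_isometry_cinner(2)[OF E that iso[OF that]] that
        by (simp add: cinner_diff_left cinner_adj_on'[OF b(2), symmetric] bounded_op_in[OF b(3)])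
    qed
    thus "A x = P (adj_on M B x)" using BP[OF x] by simp
    have "adj_on M A (P x) - B x = 0"
    proof (rule eq_0_if_cinner_self_0[OF bounded_op_minus_op[OF bounded_op_comp[OF bounded_op_adj_on[OF b(1)] b(3)] b(2)] _ x])
      show "cinner (adj_on M A (P y) - B y) y = 0" if "y \<in> M" for y
        using E_contraction_isometry_cinner(1)[OF E that iso[OF that]] that
        by (simp add: cinner_diff_left cinner_adj_on'[OF b(1), symmetric] bounded_op_in[OF b(3)])
    qed
    thus "B x = P (adj_on M A x)" using AP[OF x] by simp
  qed
  have kill: "S x = 0"
    if S: "bounded_op_on M S" and SP: "\<And>x. x \<in> M \<Longrightarrow> adj_on M S (P x) = P (adj_on M S x)"
      and R: "\<And>x. x \<in> M \<Longrightarrow> S x = P (R x)" "\<And>x. x \<in> M \<Longrightarrow> R x \<in> M" for S R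
  proof -
    have zero: "adj_on M S y = 0" if y: "y \<in> M" for y
    proof (rule cnu_isometry_annihilates[OF cnu iso bounded_op_adj_on[OF S] SP _ y])
      fix e assume e: "e \<in> M" and orth: "\<And>x. x \<in> M \<Longrightarrow> cinner (P x) e = 0"
      show "adj_on M S e = 0"
        by (rule adj_on_eqI[OF S e csubspace_zero[OF bounded_op_csubspace[OF S]]])
          (simp add: R orth)
    qed
    have "cinner (S x) (S x) = 0"
      using cinner_adj_on[OF S bounded_op_in[OF S x] x] zero[OF bounded_op_in[OF S x]] by simp
    thus ?thesis by simp
  qed
  show "A x = 0" by (rule kill[OF b(1) AP A]) (auto intro: adj_on_in b)
  show "B x = 0" by (rule kill[OF b(2) BP B]) (auto intro: adj_on_in b)
qed


section \<open>Unitary extension of an isometry in the space of sequences\<close>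

lemma summable_norm_sq_case:
  "summable (\<lambda>n. (norm (case n of 0 \<Rightarrow> x | Suc k \<Rightarrow> f k))\<^sup>2) \<longleftrightarrow> summable (\<lambda>n. (norm (f n))\<^sup>2)"
  by (subst summable_Suc_iff[symmetric]) simp

lift_definition ell2_cons :: "'a::complex_hilbert \<Rightarrow> 'a ell2 \<Rightarrow> 'a ell2" is
  "\<lambda>x f n. case n of 0 \<Rightarrow> x | Suc k \<Rightarrow> f k"
  by (simp add: summable_norm_sq_case)

lift_definition ell2_tl :: "'a::complex_hilbert ell2 \<Rightarrow> 'a ell2" is "\<lambda>f n. f (Suc n)"
  by (drule summable_Suc_iff[THEN iffD2])

lemma ell2_eqI: "(\<And>n. ell2_nth f n = ell2_nth g n) \<Longrightarrow> f = g"
  by (simp add: ell2_nth_inject[symmetric] fun_eq_iff)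

lemma norm_ell2_cons: "(norm (ell2_cons x f))\<^sup>2 = (norm x)\<^sup>2 + (norm f)\<^sup>2"
  using suminf_split_head[OF ell2_nth_summable[of "ell2_cons x f"]]
  by (simp add: norm_ell2_sq ell2_cons.rep_eq)

lemma norm_ell2_split: "(norm f)\<^sup>2 = (norm (ell2_nth f 0))\<^sup>2 + (norm (ell2_tl f))\<^sup>2"
proof -
  have "f = ell2_cons (ell2_nth f 0) (ell2_tl f)"
    by (rule ell2_eqI) (simp add: ell2_cons.rep_eq ell2_tl.rep_eq split: nat.split)
  thus ?thesis by (metis norm_ell2_cons)
qed

lemmas ell2_nth_simps = ell2_cons.rep_eq ell2_tl.rep_eq plus_ell2.rep_eq scaleC_ell2.rep_eq zero_ell2.rep_eq

text \<open>With \<open>E\<close> the wandering subspace of the isometry \<open>V\<close>, the operator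
  \<open>U (x, e\<^sub>1, e\<^sub>2, \<dots>) = (V x + e\<^sub>1, e\<^sub>2, e\<^sub>3, \<dots>)\<close> on \<open>M \<oplus> E \<oplus> E \<oplus> \<dots>\<close> extends \<open>V\<close>, and it is unitary because
  \<open>M = V M \<oplus> E\<close>.\<close>

theorem isometry_unitary_extension:
  fixes V :: "'a::complex_hilbert \<Rightarrow> 'a"
  assumes V: "bounded_op_on M V" and iso: "\<And>x. x \<in> M \<Longrightarrow> norm (V x) = norm x"
  obtains K :: "'a ell2 set" and U where
    "unitary_on K U" "\<And>x. x \<in> M \<Longrightarrow> ell2_cons x 0 \<in> K"
    "\<And>x. x \<in> M \<Longrightarrow> ell2_cons (V x) 0 = U (ell2_cons x 0)"
proof -
  note M = bounded_op_csubspace[OF V]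
  define E where "E = M \<inter> orth_compl (V ` M)"
  have E: "closed_csubspace E"
    using M csubspace_orth_compl[of "V ` M"] by (auto simp: E_def closed_csubspace_def)
  define K where "K = {f :: 'a ell2. ell2_nth f 0 \<in> M \<and> (\<forall>n. ell2_nth f (Suc n) \<in> E)}"
  have K: "closed_csubspace K"
  proof -
    have "f \<in> K" if F: "\<And>k. F k \<in> K" and lim: "F \<longlonglongrightarrow> f" for F f
    proof -
      have nth: "(\<lambda>k. ell2_nth (F k) n) \<longlonglongrightarrow> ell2_nth f n" for n
      proof (rule LIM_zero_cancel, rule tendsto_0_le[where K = 1])
        show "(\<lambda>k. F k - f) \<longlonglongrightarrow> 0" using lim by (rule LIM_zero)
        show "\<forall>\<^sub>F k in sequentially. norm (ell2_nth (F k) n - ell2_nth f n) \<le> norm (F k - f) * 1"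
          using norm_ell2_nth_le[of "F _ - f" n] by (simp add: minus_ell2.rep_eq)
      qed
      show ?thesis
        using F closed_sequentially[OF csubspace_closed[OF M] _ nth]
          closed_sequentially[OF csubspace_closed[OF E] _ nth] by (auto simp: K_def)
    qed
    hence "closed K" unfolding closed_sequential_limits by blast
    thus ?thesis
      using M E by (auto simp: closed_csubspace_def K_def ell2_nth_simps)
  qed
  define U where "U f = ell2_cons (V (ell2_nth f 0) + ell2_nth f 1) (ell2_tl (ell2_tl f))" for f
  have UK: "U f \<in> K" if "f \<in> K" for f
    using that by (auto simp: K_def U_def E_def ell2_nth_simps intro!: csubspace_add[OF M] bounded_op_in[OF V])
  have norm_U: "norm (U f) = norm f" if f: "f \<in> K" for f
  proof -
    have "ell2_nth f 0 \<in> M" "ell2_nth f (Suc 0) \<in> E" using f by (auto simp: K_def)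
    hence "cinner (ell2_nth f 1) (V (ell2_nth f 0)) = 0" and "norm (V (ell2_nth f 0)) = norm (ell2_nth f 0)"
      using iso by (auto simp: E_def orth_compl_def)
    hence "(norm (V (ell2_nth f 0) + ell2_nth f 1))\<^sup>2 = (norm (ell2_nth f 0))\<^sup>2 + (norm (ell2_nth f 1))\<^sup>2"
      using norm_add_sq[of "ell2_nth f 1" "V (ell2_nth f 0)"] by (simp add: add.commute)
    hence "(norm (U f))\<^sup>2 = (norm f)\<^sup>2"
      using norm_ell2_split[of f] norm_ell2_split[of "ell2_tl f"]
      by (simp add: U_def norm_ell2_cons ell2_tl.rep_eq)
    thus ?thesis by simp
  qed
  have bU: "bounded_op_on K U"
  proof (rule bounded_op_onI[where K = 1, OF K])
    show "U (f + g) = U f + U g" if "f \<in> K" "g \<in> K" for f g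
      using that by (intro ell2_eqI)
        (auto simp: U_def K_def ell2_nth_simps bounded_op_add[OF V] split: nat.split)
    show "U (c *\<^sub>C f) = c *\<^sub>C U f" if "f \<in> K" for c f
      using that by (intro ell2_eqI)
        (auto simp: U_def K_def ell2_nth_simps bounded_op_scaleC[OF V] scaleC_add_right split: nat.split)
  qed (simp_all add: UK norm_U)
  have "K \<subseteq> U ` K"
  proof
    fix g assume g: "g \<in> K"
    hence g0: "ell2_nth g 0 \<in> M" by (simp add: K_def)
    obtain x where x: "x \<in> M" and orth: "\<And>w. w \<in> M \<Longrightarrow> cinner (V w) (ell2_nth g 0 - V x) = 0"
      using orthogonal_projection_exists[OF csubspace_isometric_image[OF V iso], of "ell2_nth g 0"] by auto
    let ?e = "ell2_nth g 0 - V x"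
    have "cinner ?e (V w) = 0" if "w \<in> M" for w
      using orth[OF that] cinner_commute[of ?e "V w"] by simp
    hence e: "?e \<in> E"
      using csubspace_diff[OF M g0 bounded_op_in[OF V x]] by (auto simp: E_def orth_compl_def)
    let ?f = "ell2_cons x (ell2_cons ?e (ell2_tl g))"
    have "?f \<in> K" using g x e by (auto simp: K_def ell2_nth_simps split: nat.split)
    moreover have "U ?f = g"
      by (rule ell2_eqI) (simp add: U_def ell2_nth_simps split: nat.split)
    ultimately show "g \<in> U ` K" by force
  qed
  hence "unitary_on K U" using UK norm_U by (intro unitary_onI[OF bU]) auto
  moreover have "ell2_cons x 0 \<in> K" if "x \<in> M" for x
    using that csubspace_zero[OF E] by (simp add: K_def ell2_nth_simps)
  moreover have "ell2_cons (V x) 0 = U (ell2_cons x 0)" for x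
    by (rule ell2_eqI) (simp add: U_def ell2_nth_simps split: nat.split)
  ultimately show ?thesis using that by blast
qed

lemma unitary_minus_scalar_bij_betw:
  assumes U: "unitary_on K U" and c: "cmod c \<noteq> 1"
  shows "bij_betw (\<lambda>x. U x - c *\<^sub>C x) K K"
proof -
  have b: "bounded_op_on K U" using U by (simp add: unitary_on_def)
  note K = bounded_op_csubspace[OF b]
  have b': "bounded_op_on K (\<lambda>x. U x - c *\<^sub>C x)"
    by (intro bounded_op_minus_op b bounded_op_scale bounded_op_ident K)
  show ?thesis
  proof (cases "cmod c < 1")
    case True
    show ?thesis
      by (rule bij_betw_perturb[OF b b' unitary_bij_betw[OF U], where c = 1 and d = "cmod c"])
        (use True unitary_norm[OF U] in \<open>auto simp: norm_scaleC\<close>)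
  next
    case False
    hence c: "1 < cmod c" "c \<noteq> 0" using c by auto
    show ?thesis
      by (rule bij_betw_perturb[OF bounded_op_scale[OF bounded_op_ident[OF K], of "- c"] b'
            bij_betw_scaleC[OF K], where c = "cmod c" and d = 1])
        (use c unitary_norm[OF U] in \<open>auto simp: norm_scaleC\<close>)
  qed
qed

text \<open>Unless \<open>a = b = 0\<close> and \<open>\<bar>c\<bar> = 1\<close>, one of \<open>-a\<close>, \<open>-b\<close> and \<open>U - c\<close> is invertible, which makes
  the Koszul complex exact; and \<open>(0, 0, c)\<close> with \<open>\<bar>c\<bar> = 1\<close> lies in the distinguished boundary.\<close>

lemma E_unitary_zero_zero:
  assumes U: "unitary_on K U"
  shows "E_unitary_on K (\<lambda>_. 0) (\<lambda>_. 0) U"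
proof -
  have b: "bounded_op_on K U" using U by (simp add: unitary_on_def)
  note K = bounded_op_csubspace[OF b]
  note b0 = bounded_op_0[OF K]
  have triple: "commuting_triple_on K (\<lambda>_. 0) (\<lambda>_. 0) U"
    using b b0 by (simp add: commuting_triple_on_def bounded_op_zero[OF b])
  have "normal_on K (\<lambda>_. 0)"
    using b0 by (auto simp: normal_on_def intro: adj_on_eqI csubspace_zero[OF K])
  moreover have "normal_on K U" using U by (simp add: normal_on_def unitary_on_def)
  moreover have "taylor_spectrum_on K (\<lambda>_. 0) (\<lambda>_. 0) U \<subseteq> b_tetrablock"
  proof (clarify, rule ccontr)
    fix a b' c assume spec: "(a, b', c) \<in> taylor_spectrum_on K (\<lambda>_. 0) (\<lambda>_. 0) U"
      and out: "(a, b', c) \<notin> b_tetrablock"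
    have "(0, 0, c) \<in> closure tetrablock" if "cmod c = 1"
      unfolding closure_tetrablock_iff
    proof (intro allI impI)
      fix z w :: complex assume zw: "cmod z < 1" "cmod w < 1"
      have "cmod (z * w * c) < 1"
        using zw that mult_strict_mono[of "cmod z" 1 "cmod w" 1] by (simp add: norm_mult)
      hence "z * w * c \<noteq> -1" by auto
      thus "1 - z * 0 - w * 0 + z * w * c \<noteq> 0" by (metis add.inverse_unique add.commute diff_zero mult_zero_right)
    qed
    hence cases: "a \<noteq> 0 \<or> b' \<noteq> 0 \<or> cmod c \<noteq> 1" using out by (auto simp: b_tetrablock_def)
    have bs: "bounded_op_on K (\<lambda>x. 0 - a *\<^sub>C x)" "bounded_op_on K (\<lambda>x. 0 - b' *\<^sub>C x)"
      "bounded_op_on K (\<lambda>x. U x - c *\<^sub>C x)"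
      by (intro bounded_op_minus_op b b0 bounded_op_scale bounded_op_ident K)+
    have exact: "koszul_exact_on K (\<lambda>x. 0 - a *\<^sub>C x) (\<lambda>x. 0 - b' *\<^sub>C x) (\<lambda>x. U x - c *\<^sub>C x)"
      if "bij_betw (\<lambda>x. \<alpha> *\<^sub>C (0 - a *\<^sub>C x) + \<beta> *\<^sub>C (0 - b' *\<^sub>C x) + \<gamma> *\<^sub>C (U x - c *\<^sub>C x)) K K" for \<alpha> \<beta> \<gamma>
      by (rule koszul_exact_onI[OF bs _ _ _ that])
        (simp_all add: bounded_op_minus[OF b] bounded_op_scaleC[OF b] csubspace_scaleC[OF K]
          scaleC.scale_right_diff_distrib scaleC_scaleC mult.commute)
    have "koszul_exact_on K (\<lambda>x. 0 - a *\<^sub>C x) (\<lambda>x. 0 - b' *\<^sub>C x) (\<lambda>x. U x - c *\<^sub>C x)"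
      using cases
    proof (elim disjE)
      assume "a \<noteq> 0"
      thus ?thesis using exact[of 1 0 0] bij_betw_scaleC[OF K, of "- a"] by simp
    next
      assume "b' \<noteq> 0"
      thus ?thesis using exact[of 0 1 0] bij_betw_scaleC[OF K, of "- b'"] by simp
    next
      assume "cmod c \<noteq> 1"
      thus ?thesis using exact[of 0 0 1] unitary_minus_scalar_bij_betw[OF U] by simp
    qed
    thus False using spec by (simp add: taylor_spectrum_on_def)
  qed
  ultimately show ?thesis using triple by (simp add: E_unitary_on_def)
qed

lemma E_isometry_zero_zero:
  assumes V: "bounded_op_on M V" and iso: "\<And>x. x \<in> M \<Longrightarrow> norm (V x) = norm x"
    and triple: "commuting_triple_on M A B V"
    and zero: "\<And>x. x \<in> M \<Longrightarrow> A x = 0" "\<And>x. x \<in> M \<Longrightarrow> B x = 0"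
  shows "E_isometry_on M A B V"
proof -
  obtain K :: "'a ell2 set" and U where K: "unitary_on K U" "\<And>x. x \<in> M \<Longrightarrow> ell2_cons x 0 \<in> K"
    "\<And>x. x \<in> M \<Longrightarrow> ell2_cons (V x) 0 = U (ell2_cons x 0)"
    using isometry_unitary_extension[OF V iso] by blast
  let ?J = "\<lambda>x. ell2_cons x 0"
  have "?J (x + y) = ?J x + ?J y" "?J (c *\<^sub>C x) = c *\<^sub>C ?J x" "?J 0 = 0" for x y :: 'a and c
    by (rule ell2_eqI; simp add: ell2_nth_simps split: nat.split)+
  moreover have "norm (?J x) = norm x" for x :: 'a
  proof -
    have "(norm (?J x))\<^sup>2 = (norm x)\<^sup>2" by (simp add: norm_ell2_cons)
    thus ?thesis by simp
  qed
  ultimately show ?thesis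
    unfolding E_isometry_on_def using triple K zero E_unitary_zero_zero[OF K(1)]
    by (intro conjI exI[of _ K] exI[of _ "\<lambda>_. 0"] exI[of _ U] exI[of _ ?J]) auto
qed


section \<open>The decomposition of a doubly commuting E-contraction\<close>

theorem theorem5p8:
  fixes A B P :: "'a::complex_hilbert \<Rightarrow> 'a"
  assumes "cnu_E_contraction_on UNIV A B P"
    and "\<And>x. adj A (P x) = P (adj A x)"
    and "\<And>x. adj B (P x) = P (adj B x)"
  shows "joint_invariant_subspace A B P (decomp_H1 P) \<and> joint_invariant_subspace A B P (decomp_H3 P) \<and>
    joint_invariant_subspace (adj A) (adj B) (adj P) (decomp_H2 P) \<and>
    pure_E_contraction_on (decomp_H1 P) (adj_on (decomp_H1 P) A) (adj_on (decomp_H1 P) B) (adj_on (decomp_H1 P) P) \<and>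
    cnu_E_contraction_on (decomp_H2 P) (adj A) (adj B) (adj P) \<and>
    cnu_E_isometry_on (decomp_H3 P) A B P"
proof -
  let ?H1 = "decomp_H1 P" and ?H2 = "decomp_H2 P" and ?H3 = "decomp_H3 P"
  have E: "E_contraction_on UNIV A B P" and cnu: "cnu_on UNIV P"
    using assms(1) by (auto simp: cnu_E_contraction_on_def)
  have P: "contraction_on UNIV P" using cnu by (simp add: cnu_on_def)
  have triple: "commuting_triple_on UNIV A B P" using E by (simp add: E_contraction_on_iff)
  note b = triple_bounded[OF triple] and comm = triple_commute[OF triple]
  have H1: "joint_invariant_subspace A B P ?H1"
    using decomp_H1_invariant[OF b(1), of P] decomp_H1_invariant[OF b(2), of P]
      decomp_H1_invariant[OF b(3), of P] comm csubspace_decomp_H1[OF P]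
    by (simp add: joint_invariant_subspace_def invariant_subspace_def)
  have H3: "joint_invariant_subspace A B P ?H3"
    using decomp_H3_invariant[OF P b(1) _ assms(2)] decomp_H3_invariant[OF P b(2) _ assms(3)]
      decomp_H3_invariant_self[OF P] comm csubspace_decomp_H3[OF P]
    by (simp add: joint_invariant_subspace_def invariant_subspace_def)
  have H2: "joint_invariant_subspace (adj A) (adj B) (adj P) ?H2"
  proof -
    have "T ` {x + y | x y. x \<in> ?H1 \<and> y \<in> ?H3} \<subseteq> {x + y | x y. x \<in> ?H1 \<and> y \<in> ?H3}"
      if T: "bounded_op_on UNIV T" and "T ` ?H1 \<subseteq> ?H1" "T ` ?H3 \<subseteq> ?H3" for T
      using that(2,3) by (force simp: bounded_op_add[OF T])
    hence "adj T ` ?H2 \<subseteq> ?H2" if "bounded_op_on UNIV T" "T ` ?H1 \<subseteq> ?H1" "T ` ?H3 \<subseteq> ?H3" for T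
      using that unfolding decomp_H2_def by (intro adj_orth_compl_invariant)
    thus ?thesis
      using H1 H3 b csubspace_orth_compl
      by (simp add: joint_invariant_subspace_def invariant_subspace_def decomp_H2_def)
  qed
  have "pure_E_contraction_on ?H1 (adj_on ?H1 A) (adj_on ?H1 B) (adj_on ?H1 P)"
  proof -
    have E1: "E_contraction_on ?H1 A B P" by (rule E_contraction_restrict[OF E H1]) simp
    hence b1: "bounded_op_on ?H1 P" by (auto simp: E_contraction_on_iff dest: triple_bounded)
    have "(adj_on ?H1 (adj_on ?H1 P) ^^ k) x = (P ^^ k) x" if "x \<in> ?H1" for k x
    proof (induction k)
      case (Suc k)
      then show ?case
        using adj_on_adj_on[OF b1 bounded_op_in[OF bounded_op_pow[OF b1] that]] by simp
    qed simp
    hence "pure_on ?H1 (adj_on ?H1 P)" by (simp add: pure_on_def) (simp add: decomp_H1_def)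
    thus ?thesis using E_contraction_adj_on[OF E1] by (simp add: pure_E_contraction_on_def)
  qed
  moreover have "cnu_E_contraction_on ?H2 (adj A) (adj B) (adj P)"
    using E_contraction_restrict[OF E_contraction_adj_on[OF E] H2] cnu_restrict[OF cnu_adj_on[OF cnu], of ?H2] H2
    by (simp add: cnu_E_contraction_on_def joint_invariant_subspace_def)
  moreover have "cnu_E_isometry_on ?H3 A B P"
  proof -
    have E3: "E_contraction_on ?H3 A B P" by (rule E_contraction_restrict[OF E H3]) simp
    hence triple3: "commuting_triple_on ?H3 A B P" by (simp add: E_contraction_on_iff)
    note b3 = triple_bounded[OF triple3]
    have cnu3: "cnu_on ?H3 P"
      using cnu_restrict[OF cnu, of ?H3] H3 by (simp add: joint_invariant_subspace_def)
    have iso: "norm (P x) = norm x" if "x \<in> ?H3" for x by (rule norm_decomp_H3[OF P that])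
    \<comment> \<open>\<open>?H3\<close> also reduces \<open>A\<close> and \<open>B\<close>, so there the adjoints of the restrictions are restrictions of
      the adjoints.\<close>
    have adj3: "adj_on ?H3 S (P x) = P (adj_on ?H3 S x)"
      if S: "bounded_op_on UNIV S" "bounded_op_on ?H3 S" and SP: "\<And>x. S (P x) = P (S x)"
        and adjSP: "\<And>x. adj S (P x) = P (adj S x)" and x: "x \<in> ?H3" for S x
    proof -
      have "adj S ` ?H3 \<subseteq> ?H3"
        by (rule decomp_H3_invariant[OF P bounded_op_adj_on[OF S(1)] adjSP])
          (simp add: adj_on_adj_on[OF S(1)] SP)
      hence "adj_on ?H3 S y = adj S y" if "y \<in> ?H3" for y
        using that by (intro adj_on_eqI[OF S(2)]) (auto simp: cinner_adj_on[OF S(1)])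
      thus ?thesis using x bounded_op_in[OF b3(3) x] by (simp add: adjSP)
    qed
    have "A x = 0" "B x = 0" if "x \<in> ?H3" for x
      using E_contraction_cnu_isometry_zero[OF E3 cnu3 iso _ _ that]
        adj3[OF b(1) b3(1) _ assms(2)] adj3[OF b(2) b3(2) _ assms(3)] comm by simp_all
    hence "E_isometry_on ?H3 A B P" using iso by (intro E_isometry_zero_zero b3 triple3)
    thus ?thesis using cnu3 by (simp add: cnu_E_isometry_on_def)
  qed
  ultimately show ?thesis using H1 H2 H3 by blast
qed

end
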